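(* The following categories do not have binary products (that is, in each of them some pair of objects has no product): (1) $\mathsf{TopOpen}$, the category of topological spaces and open maps; (2) $\mathsf{TopOpen}_0$, the full subcategory of $\mathsf{TopOpen}$ consisting of $T_0$-spaces; (3) $\mathsf{SobOpen}$, the full subcategory of $\mathsf{TopOpen}$ consisting of sober spaces.
   Context: An open map between topological spaces is a continuous map such that the image of each open set is open. A topological space is sober if each nonempty closed set that is not the union of two proper closed subsets is the closure of a unique point. *)

theory Defs
  imports "HOL-Analysis.Analysis"
begin

section \<open>Categories and binary products\<close>

text \<open>
  Hom-sets and composition are indexed by objects, so hom-sets of different pairs of objects need
  not be disjoint. \<open>Comp C X Y Z g f\<close> is the composite of \<open>f \<in> Hom C X Y\<close> and \<open>g \<in> Hom C Y Z\<close>.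
\<close>

record ('o, 'm) cat =
  Obj :: "'o set"
  Hom :: "'o \<Rightarrow> 'o \<Rightarrow> 'm set"
  Ident :: "'o \<Rightarrow> 'm"
  Comp :: "'o \<Rightarrow> 'o \<Rightarrow> 'o \<Rightarrow> 'm \<Rightarrow> 'm \<Rightarrow> 'm"

definition is_category :: "('o, 'm) cat \<Rightarrow> bool" where
  "is_category C \<longleftrightarrow>
     (\<forall>X\<in>Obj C. Ident C X \<in> Hom C X X) \<and>
     (\<forall>X\<in>Obj C. \<forall>Y\<in>Obj C. \<forall>Z\<in>Obj C. \<forall>f\<in>Hom C X Y. \<forall>g\<in>Hom C Y Z.
        Comp C X Y Z g f \<in> Hom C X Z) \<and>
     (\<forall>X\<in>Obj C. \<forall>Y\<in>Obj C. \<forall>f\<in>Hom C X Y.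
        Comp C X X Y f (Ident C X) = f \<and> Comp C X Y Y (Ident C Y) f = f) \<and>
     (\<forall>W\<in>Obj C. \<forall>X\<in>Obj C. \<forall>Y\<in>Obj C. \<forall>Z\<in>Obj C.
        \<forall>f\<in>Hom C W X. \<forall>g\<in>Hom C X Y. \<forall>h\<in>Hom C Y Z.
        Comp C W X Z (Comp C X Y Z h g) f = Comp C W Y Z h (Comp C W X Y g f))"

definition full_subcategory :: "('o, 'm) cat \<Rightarrow> ('o \<Rightarrow> bool) \<Rightarrow> ('o, 'm) cat" where
  "full_subcategory C Q = C\<lparr>Obj := {X \<in> Obj C. Q X}\<rparr>"

definition is_binary_product ::
    "('o, 'm) cat \<Rightarrow> 'o \<Rightarrow> 'o \<Rightarrow> 'o \<Rightarrow> 'm \<Rightarrow> 'm \<Rightarrow> bool" where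
  "is_binary_product C X Y P p q \<longleftrightarrow>
     P \<in> Obj C \<and> p \<in> Hom C P X \<and> q \<in> Hom C P Y \<and>
     (\<forall>Z\<in>Obj C. \<forall>f\<in>Hom C Z X. \<forall>g\<in>Hom C Z Y.
        \<exists>!h. h \<in> Hom C Z P \<and> Comp C Z P X p h = f \<and> Comp C Z P Y q h = g)"

definition has_binary_products :: "('o, 'm) cat \<Rightarrow> bool" where
  "has_binary_products C \<longleftrightarrow>
     (\<forall>X\<in>Obj C. \<forall>Y\<in>Obj C. \<exists>P p q. is_binary_product C X Y P p q)"

lemma is_category_full_subcategory:
  "is_category C \<Longrightarrow> is_category (full_subcategory C Q)"
  unfolding is_category_def full_subcategory_def by simp


section \<open>Smallness\<close>

text \<open>
  HOL cannot quantify over types inside a formula, so the points of all spaces are taken from one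
  type \<open>'u\<close>, and the predicate \<open>small\<close> says which subsets of \<open>'u\<close> count as sets; a subset that is
  not small plays the role of a proper class. Only closure under subsets and images (separation
  and replacement) and the existence of an infinite small set are required.

  If \<open>'u\<close> is a type of all ZFC sets and \<open>small\<close> means being the extension of a set, the objects
  below are literally all topological spaces. The same holds relative to a Grothendieck universe
  that contains an infinite set. Other instances are \<open>\<lambda>_. True\<close> on an infinite type, which gives
  all spaces of at most the cardinality of that type up to homeomorphism, and \<open>countable\<close>.
\<close>

definition smallness :: "('u set \<Rightarrow> bool) \<Rightarrow> bool" where
  "smallness small \<longleftrightarrow>
     (\<forall>A B. small A \<longrightarrow> B \<subseteq> A \<longrightarrow> small B) \<and>
     (\<forall>A (f :: 'u \<Rightarrow> 'u). small A \<longrightarrow> small (f ` A)) \<and>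
     (\<exists>A. small A \<and> infinite A)"

lemma smallness_UNIV: "infinite (UNIV :: 'u set) \<Longrightarrow> smallness (\<lambda>A :: 'u set. True)"
  unfolding smallness_def by blast

lemma smallness_countable:
  assumes "infinite (UNIV :: 'u set)"
  shows "smallness (countable :: 'u set \<Rightarrow> bool)"
  unfolding smallness_def
  using infinite_countable_subset'[OF assms] by (auto intro: countable_subset)


section \<open>Spaces and open maps\<close>

text \<open>
  \<open>A\<close> and \<open>B\<close> may be taken closed in \<open>X\<close>, since a subset of the closed set \<open>F\<close> is closed in \<open>F\<close>
  if and only if it is closed in \<open>X\<close>.
\<close>

definition sober_space :: "'a topology \<Rightarrow> bool" where
  "sober_space X \<longleftrightarrow>
     (\<forall>F. closedin X F \<and> F \<noteq> {} \<and>
          \<not> (\<exists>A B. closedin X A \<and> closedin X B \<and> A \<subset> F \<and> B \<subset> F \<and> F = A \<union> B)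
        \<longrightarrow> (\<exists>!x. x \<in> topspace X \<and> F = X closure_of {x}))"

text \<open>
  The library's \<open>open_map\<close> does not include continuity. Morphisms are extensional functions, so
  that two morphisms are equal as soon as they agree on the points of the domain.
\<close>

definition open_maps :: "'a topology \<Rightarrow> 'b topology \<Rightarrow> ('a \<Rightarrow> 'b) set" where
  "open_maps X Y =
     {f \<in> extensional (topspace X). continuous_map X Y f \<and> open_map X Y f}"

definition TopOpen :: "('u set \<Rightarrow> bool) \<Rightarrow> ('u topology, 'u \<Rightarrow> 'u) cat" where
  "TopOpen small =
     \<lparr>Obj = {X. small (topspace X)},
      Hom = open_maps,
      Ident = (\<lambda>X. \<lambda>x\<in>topspace X. x),
      Comp = (\<lambda>X Y Z g f. compose (topspace X) g f)\<rparr>"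

definition TopOpen0 :: "('u set \<Rightarrow> bool) \<Rightarrow> ('u topology, 'u \<Rightarrow> 'u) cat" where
  "TopOpen0 small = full_subcategory (TopOpen small) t0_space"

definition SobOpen :: "('u set \<Rightarrow> bool) \<Rightarrow> ('u topology, 'u \<Rightarrow> 'u) cat" where
  "SobOpen small = full_subcategory (TopOpen small) sober_space"

lemma id_in_open_maps: "(\<lambda>x\<in>topspace X. x) \<in> open_maps X X"
proof -
  have "continuous_map X X (\<lambda>x\<in>topspace X. x)"
    by (rule continuous_map_eq[OF continuous_map_id]) simp
  moreover have "open_map X X (\<lambda>x\<in>topspace X. x)"
    by (rule open_map_eq[OF open_map_id]) simp
  ultimately show ?thesis by (simp add: open_maps_def)
qed

lemma compose_in_open_maps:
  assumes "f \<in> open_maps X Y" "g \<in> open_maps Y Z"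
  shows "compose (topspace X) g f \<in> open_maps X Z"
proof -
  have "continuous_map X Z (g \<circ> f)" "open_map X Z (g \<circ> f)"
    using assms by (auto simp: open_maps_def intro: continuous_map_compose open_map_compose)
  then have "continuous_map X Z (compose (topspace X) g f)"
    "open_map X Z (compose (topspace X) g f)"
    by (auto simp: compose_eq elim: continuous_map_eq open_map_eq)
  then show ?thesis by (simp add: open_maps_def)
qed

lemma open_maps_funcset: "f \<in> open_maps X Y \<Longrightarrow> f \<in> topspace X \<rightarrow> topspace Y"
  by (simp add: open_maps_def continuous_map_funspace)

lemma is_category_TopOpen: "is_category (TopOpen small)"
  unfolding is_category_def TopOpen_def
  by (simp add: id_in_open_maps compose_in_open_maps)
     (auto simp: open_maps_def fun_eq_iff compose_def extensional_def continuous_map_def Pi_iff)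

lemma is_category_TopOpen0: "is_category (TopOpen0 small)"
  unfolding TopOpen0_def by (rule is_category_full_subcategory[OF is_category_TopOpen])

lemma is_category_SobOpen: "is_category (SobOpen small)"
  unfolding SobOpen_def by (rule is_category_full_subcategory[OF is_category_TopOpen])

end

theory Submission
  imports Defs
begin

text \<open>
  In each of the three categories the square of one particular space, the \<open>ladder\<close>, does not exist. A
  product \<open>P\<close> would be terminal among the spaces coloured by two open maps to the ladder. Open maps
  preserve what a point can see in its neighbourhoods, so, as for bisimulations, points that see
  different things cannot be identified by a map to \<open>P\<close>. One can therefore try to make \<open>P\<close> contain a
  point for each of its subsets, which contradicts Cantor's theorem.

  Such a point should have a prescribed set of points of \<open>P\<close> as what it sees. Seeing a point means
  seeing everything near it, so the points of \<open>P\<close> themselves do not give enough sets. Instead one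
  forms \<open>marked_copy P\<close>, in which each \<open>x\<close> has a private mark \<open>Mark x\<close>. To keep the marks distinguishable
  from the old points, \<open>P\<close> is recoloured so that it no longer uses the colour that the marks see. This
  is possible because the ladder is self-similar: shifting it down one level is an embedding that
  frees its first level. The shift can be undone on the image of the copy, and the universal property
  then makes the map from the copy to \<open>P\<close> injective (\<open>inj_on_h_Base\<close>); its extension to the marks is
  injective because \<open>P\<close> is \<open>T\<^sub>0\<close> (\<open>inj_on_h_Mark\<close>).

  For each set \<open>S\<close> of points of \<open>P\<close> a single further point is adjoined below the marks of \<open>S\<close>. Its image
  in \<open>P\<close> determines \<open>S\<close> (\<open>decode_surj\<close>), and the diagonal argument gives the contradiction. Adjoining
  only one point at a time keeps each test space as small as \<open>P\<close>, or countable, so the argument works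
  for every notion of smallness.

  The test spaces have to lie in the category at hand. They are piles of discrete spaces and a
  copy of \<open>P\<close>, or locally closed subspaces of \<open>P\<close>, and both constructions preserve the \<open>T\<^sub>0\<close> axiom
  and sobriety
  (\<open>separation_stratified\<close>, \<open>separation_subtopology_locally_closed\<close>).
\<close>

section \<open>Sober spaces in terms of open sets\<close>

text \<open>
  Irreducibility and genericity are restated with open sets, because in this form both pass to
  subspaces by intersecting.
\<close>
lemma irreducible_closed_iff_open_sets_meet:
  assumes "closedin X F"
  shows "\<not> (\<exists>A B. closedin X A \<and> closedin X B \<and> A \<subset> F \<and> B \<subset> F \<and> F = A \<union> B) \<longleftrightarrow>
         (\<forall>U V. openin X U \<longrightarrow> openin X V \<longrightarrow> F \<inter> U \<noteq> {} \<longrightarrow> F \<inter> V \<noteq> {} \<longrightarrow> F \<inter> U \<inter> V \<noteq> {})"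
    (is "\<not> ?reducible \<longleftrightarrow> ?meet")
proof
  assume irred: "\<not> ?reducible"
  show ?meet
  proof (intro allI impI notI)
    fix U V
    assume U: "openin X U" "F \<inter> U \<noteq> {}" and V: "openin X V" "F \<inter> V \<noteq> {}" and "F \<inter> U \<inter> V = {}"
    then have "F - U \<subset> F" "F - V \<subset> F" "F = (F - U) \<union> (F - V)"
      by blast+
    moreover have "closedin X (F - U)" "closedin X (F - V)"
      using assms U V by (auto intro: closedin_diff)
    ultimately show False
      using irred by blast
  qed
next
  assume meet: ?meet
  show "\<not> ?reducible"
  proof
    assume ?reducible
    then obtain A B where AB: "closedin X A" "closedin X B" "A \<subset> F" "B \<subset> F" "F = A \<union> B"
      by blast
    have "F \<subseteq> topspace X"
      using assms closedin_subset by blast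
    then have "F \<inter> (topspace X - A) \<noteq> {}" "F \<inter> (topspace X - B) \<noteq> {}"
      using AB by blast+
    with AB meet have "F \<inter> (topspace X - A) \<inter> (topspace X - B) \<noteq> {}"
      by (metis openin_diff openin_topspace)
    with AB show False
      by blast
  qed
qed

lemma closure_of_singleton_subset_iff:
  assumes "x \<in> topspace X" "closedin X F"
  shows "X closure_of {x} = F \<longleftrightarrow> x \<in> F \<and> (\<forall>U. openin X U \<longrightarrow> U \<inter> F \<noteq> {} \<longrightarrow> x \<in> U)"
proof
  assume eq: "X closure_of {x} = F"
  have "x \<in> X closure_of {x}"
    using assms by (simp add: in_closure_of)
  with eq show "x \<in> F \<and> (\<forall>U. openin X U \<longrightarrow> U \<inter> F \<noteq> {} \<longrightarrow> x \<in> U)"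
    by (metis disjoint_iff empty_iff insert_iff openin_Int_closure_of_eq_empty)
next
  assume R: "x \<in> F \<and> (\<forall>U. openin X U \<longrightarrow> U \<inter> F \<noteq> {} \<longrightarrow> x \<in> U)"
  have "F \<subseteq> topspace X"
    using assms closedin_subset by blast
  then have "F \<subseteq> X closure_of {x}"
    using R unfolding closure_of_def by blast
  moreover have "X closure_of {x} \<subseteq> F"
    using R assms by (simp add: closure_of_minimal)
  ultimately show "X closure_of {x} = F"
    by blast
qed

lemma sober_imp_t0_space:
  assumes "sober_space X"
  shows "t0_space X"
  unfolding t0_space_closure_of_sing
proof (intro ballI impI)
  fix x y
  assume xy: "x \<in> topspace X" "y \<in> topspace X" "X closure_of {x} = X closure_of {y}"
  let ?F = "X closure_of {x}"
  have x: "x \<in> ?F"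
    using xy(1) by (simp add: in_closure_of)
  have "\<forall>U V. openin X U \<longrightarrow> openin X V \<longrightarrow> ?F \<inter> U \<noteq> {} \<longrightarrow> ?F \<inter> V \<noteq> {} \<longrightarrow> ?F \<inter> U \<inter> V \<noteq> {}"
    using closure_of_singleton_subset_iff[OF xy(1) closedin_closure_of, of "{x}"] by blast
  then have "\<not> (\<exists>A B. closedin X A \<and> closedin X B \<and> A \<subset> ?F \<and> B \<subset> ?F \<and> ?F = A \<union> B)"
    by (rule iffD2[OF irreducible_closed_iff_open_sets_meet[OF closedin_closure_of]])
  moreover have "?F \<noteq> {}"
    using x by blast
  ultimately have "\<exists>!z. z \<in> topspace X \<and> ?F = X closure_of {z}"
    by (intro assms[unfolded sober_space_def, rule_format] conjI closedin_closure_of)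
  with xy show "x = y"
    by metis
qed

lemma sober_space_iff:
  "sober_space X \<longleftrightarrow> t0_space X \<and>
     (\<forall>F. closedin X F \<and> F \<noteq> {} \<and>
          (\<forall>U V. openin X U \<longrightarrow> openin X V \<longrightarrow> F \<inter> U \<noteq> {} \<longrightarrow> F \<inter> V \<noteq> {} \<longrightarrow> F \<inter> U \<inter> V \<noteq> {})
        \<longrightarrow> (\<exists>x\<in>F. \<forall>U. openin X U \<longrightarrow> U \<inter> F \<noteq> {} \<longrightarrow> x \<in> U))"
    (is "_ \<longleftrightarrow> _ \<and> ?generic")
proof
  assume sober: "sober_space X"
  have ?generic
  proof (intro allI impI, elim conjE)
    fix F
    assume F: "closedin X F" "F \<noteq> {}"
      "\<forall>U V. openin X U \<longrightarrow> openin X V \<longrightarrow> F \<inter> U \<noteq> {} \<longrightarrow> F \<inter> V \<noteq> {} \<longrightarrow> F \<inter> U \<inter> V \<noteq> {}"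
    then obtain x where "x \<in> topspace X" "F = X closure_of {x}"
      using sober irreducible_closed_iff_open_sets_meet[of X F]
      unfolding sober_space_def by metis
    then show "\<exists>x\<in>F. \<forall>U. openin X U \<longrightarrow> U \<inter> F \<noteq> {} \<longrightarrow> x \<in> U"
      using closure_of_singleton_subset_iff F(1) by metis
  qed
  with sober show "t0_space X \<and> ?generic"
    using sober_imp_t0_space by blast
next
  assume R: "t0_space X \<and> ?generic"
  show "sober_space X"
    unfolding sober_space_def
  proof (intro allI impI, elim conjE)
    fix F
    assume F: "closedin X F" "F \<noteq> {}"
      "\<not> (\<exists>A B. closedin X A \<and> closedin X B \<and> A \<subset> F \<and> B \<subset> F \<and> F = A \<union> B)"
    then have "\<forall>U V. openin X U \<longrightarrow> openin X V \<longrightarrow> F \<inter> U \<noteq> {} \<longrightarrow> F \<inter> V \<noteq> {} \<longrightarrow> F \<inter> U \<inter> V \<noteq> {}"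
      using irreducible_closed_iff_open_sets_meet[OF F(1)] by (rule_tac iffD1)
    then obtain x where x: "x \<in> F" "\<forall>U. openin X U \<longrightarrow> U \<inter> F \<noteq> {} \<longrightarrow> x \<in> U"
      using R F(1,2) by blast
    have "x \<in> topspace X"
      using x(1) F(1) closedin_subset by blast
    moreover have "F = X closure_of {x}"
      using calculation closure_of_singleton_subset_iff x F(1) by metis
    ultimately show "\<exists>!x. x \<in> topspace X \<and> F = X closure_of {x}"
      using R by (intro ex1I[of _ x]) (auto simp: t0_space_closure_of_sing)
  qed
qed


section \<open>The separation conditions of the three categories\<close>

text \<open>
  One predicate for all three categories: the flags ask for the \<open>T\<^sub>0\<close> axiom and for sobriety. It is
  polymorphic in the type of points, as the test spaces below live on various types.
\<close>
definition separation :: "bool \<Rightarrow> bool \<Rightarrow> 'a topology \<Rightarrow> bool" where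
  "separation t s X \<longleftrightarrow> (t \<longrightarrow> t0_space X) \<and> (s \<longrightarrow> sober_space X)"

lemma t0_space_continuous_injection:
  assumes "t0_space X" "inj_on h (topspace Z)" "continuous_map Z X h"
  shows "t0_space Z"
  unfolding t0_space_def
proof (intro ballI impI)
  fix x y
  assume xy: "x \<in> topspace Z" "y \<in> topspace Z" "x \<noteq> y"
  then have "h x \<noteq> h y" "h x \<in> topspace X" "h y \<in> topspace X"
    using assms(2,3) by (auto simp: inj_on_def continuous_map_def)
  then obtain U where U: "openin X U" "h x \<notin> U \<longleftrightarrow> h y \<in> U"
    using assms(1) unfolding t0_space_def by metis
  have "openin Z {z \<in> topspace Z. h z \<in> U}"
    using assms(3) U(1) by (simp add: continuous_map_def)
  then show "\<exists>U. openin Z U \<and> (x \<notin> U \<longleftrightarrow> y \<in> U)"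
    using U(2) xy by blast
qed

text \<open>
  The closure of the image of an irreducible closed set \<open>F\<close> has a generic point \<open>x\<close>. It lies in \<open>C\<close>,
  which contains that closure, and in \<open>W\<close>, which meets it; so \<open>x\<close> comes from a point of \<open>Z\<close>, and
  this point is generic in \<open>F\<close>.
\<close>
lemma sober_space_locally_closed_embedding:
  assumes X: "sober_space X" and inj: "inj_on h (topspace Z)" and cont: "continuous_map Z X h"
    and emb: "\<And>U. openin Z U \<Longrightarrow> \<exists>V. openin X V \<and> U = {z \<in> topspace Z. h z \<in> V}"
    and img: "h ` topspace Z = C \<inter> W" and C: "closedin X C" and W: "openin X W"
  shows "sober_space Z"
  unfolding sober_space_iff
proof (intro conjI allI impI; (elim conjE)?)
  show "t0_space Z"
    using t0_space_continuous_injection[OF _ inj cont] X sober_imp_t0_space by blast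
next
  fix F
  assume F: "closedin Z F" "F \<noteq> {}"
    "\<forall>U V. openin Z U \<longrightarrow> openin Z V \<longrightarrow> F \<inter> U \<noteq> {} \<longrightarrow> F \<inter> V \<noteq> {} \<longrightarrow> F \<inter> U \<inter> V \<noteq> {}"
  let ?G = "X closure_of (h ` F)"
  have FZ: "F \<subseteq> topspace Z"
    using F(1) closedin_subset by blast
  have hFX: "h ` F \<subseteq> topspace X"
    using FZ cont by (auto simp: continuous_map_def)
  have meets: "U \<inter> ?G \<noteq> {} \<longleftrightarrow> F \<inter> {z \<in> topspace Z. h z \<in> U} \<noteq> {}" if "openin X U" for U
    using openin_Int_closure_of_eq_empty[OF that, of "h ` F"] FZ by blast
  have pre: "openin Z {z \<in> topspace Z. h z \<in> U}" if "openin X U" for U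
    using that cont by (simp add: continuous_map_def)
  have "?G \<inter> U \<inter> V \<noteq> {}" if "openin X U" "openin X V" "?G \<inter> U \<noteq> {}" "?G \<inter> V \<noteq> {}" for U V
  proof -
    have "F \<inter> {z \<in> topspace Z. h z \<in> U} \<inter> {z \<in> topspace Z. h z \<in> V} \<noteq> {}"
      using F(3) pre[OF that(1)] pre[OF that(2)] meets[OF that(1)] meets[OF that(2)] that(3,4)
      by (metis Int_commute)
    then have "(U \<inter> V) \<inter> ?G \<noteq> {}"
      using meets[of "U \<inter> V"] that(1,2) by blast
    then show ?thesis
      by blast
  qed
  moreover have "?G \<noteq> {}"
    using F(2) hFX closure_of_subset by fastforce
  ultimately obtain x where x: "x \<in> ?G" "\<And>U. openin X U \<Longrightarrow> U \<inter> ?G \<noteq> {} \<Longrightarrow> x \<in> U"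
    using X unfolding sober_space_iff by (metis closedin_closure_of)
  have "?G \<subseteq> C"
    using img FZ C by (intro closure_of_minimal) auto
  moreover have "x \<in> W"
    using x(2)[OF W] meets[OF W] F(2) FZ img by blast
  ultimately obtain z where z: "z \<in> topspace Z" "h z = x"
    using x(1) img by (metis IntI imageE subsetD)
  have generic: "z \<in> U" if U: "openin Z U" "U \<inter> F \<noteq> {}" for U
  proof -
    obtain V where V: "openin X V" "U = {z \<in> topspace Z. h z \<in> V}"
      using emb U(1) by blast
    then have "x \<in> V"
      using x(2)[of V] meets[of V] U(2) by blast
    with V z show ?thesis
      by blast
  qed
  have "z \<in> F"
  proof (rule ccontr)
    assume "z \<notin> F"
    obtain V where V: "openin X V" "topspace Z - F = {z \<in> topspace Z. h z \<in> V}"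
      using emb[of "topspace Z - F"] F(1) by blast
    then have "V \<inter> ?G \<noteq> {}"
      using \<open>z \<notin> F\<close> z x(1) by blast
    then show False
      using meets[OF V(1)] V(2) by blast
  qed
  with generic show "\<exists>x\<in>F. \<forall>U. openin Z U \<longrightarrow> U \<inter> F \<noteq> {} \<longrightarrow> x \<in> U"
    by blast
qed

lemma separation_locally_closed_embedding:
  assumes "separation t s X" "inj_on h (topspace Z)" "continuous_map Z X h"
    and "\<And>U. openin Z U \<Longrightarrow> \<exists>V. openin X V \<and> U = {z \<in> topspace Z. h z \<in> V}"
    and "h ` topspace Z = C \<inter> W" "closedin X C" "openin X W"
  shows "separation t s Z"
  unfolding separation_def
proof (intro conjI impI)
  assume t
  then show "t0_space Z"
    using assms(1) t0_space_continuous_injection[OF _ assms(2,3)]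
    unfolding separation_def by blast
next
  assume s
  then have "sober_space X"
    using assms(1) unfolding separation_def by blast
  then show "sober_space Z"
    by (rule sober_space_locally_closed_embedding[OF _ assms(2-7)])
qed

lemma separation_subtopology_locally_closed:
  assumes "separation t s X" "closedin X C" "openin X W"
  shows "separation t s (subtopology X (C \<inter> W))"
proof (rule separation_locally_closed_embedding[OF assms(1), where h = id])
  have "C \<inter> W \<subseteq> topspace X"
    using closedin_subset[OF assms(2)] by blast
  then show "id ` topspace (subtopology X (C \<inter> W)) = C \<inter> W"
    by auto
  show "continuous_map (subtopology X (C \<inter> W)) X id"
    by (simp add: continuous_map_from_subtopology)
  show "\<exists>V. openin X V \<and> U = {z \<in> topspace (subtopology X (C \<inter> W)). id z \<in> V}"
    if U: "openin (subtopology X (C \<inter> W)) U" for U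
  proof -
    obtain V where "openin X V" "U = V \<inter> (C \<inter> W)"
      using U by (auto simp: openin_subtopology)
    moreover have "C \<subseteq> topspace X"
      by (rule closedin_subset[OF assms(2)])
    ultimately show ?thesis
      by (intro exI[of _ V]) auto
  qed
qed (use assms in auto)

lemma separation_homeomorphic_map:
  assumes "separation t s X" "homeomorphic_map Z X h"
  shows "separation t s Z"
proof (rule separation_locally_closed_embedding[OF assms(1)])
  show "inj_on h (topspace Z)" "continuous_map Z X h"
    using assms(2) by (auto simp: homeomorphic_eq_everything_map)
  show "h ` topspace Z = topspace X \<inter> topspace X"
    using assms(2) by (auto simp: homeomorphic_eq_everything_map)
  fix U assume U: "openin Z U"
  then have "openin X (h ` U)"
    using assms(2) by (auto simp: homeomorphic_eq_everything_map open_map_def)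
  moreover have "U = {z \<in> topspace Z. h z \<in> h ` U}"
    using openin_subset[OF U] assms(2) by (auto simp: homeomorphic_eq_everything_map inj_on_def)
  ultimately show "\<exists>V. openin X V \<and> U = {z \<in> topspace Z. h z \<in> V}"
    by blast
qed auto

lemma separation_discrete:
  assumes "\<And>x. x \<in> topspace X \<Longrightarrow> openin X {x}"
  shows "separation t s X"
proof -
  have "t0_space X"
    unfolding t0_space_def using assms by (metis singletonD singletonI)
  moreover have "sober_space X"
    unfolding sober_space_iff
  proof (intro conjI allI impI; (elim conjE)?)
    fix F
    assume F: "closedin X F" "F \<noteq> {}"
      "\<forall>U V. openin X U \<longrightarrow> openin X V \<longrightarrow> F \<inter> U \<noteq> {} \<longrightarrow> F \<inter> V \<noteq> {} \<longrightarrow> F \<inter> U \<inter> V \<noteq> {}"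
    then obtain x where "x \<in> F"
      by blast
    moreover have "openin X {x}"
      using \<open>x \<in> F\<close> closedin_subset[OF F(1)] assms by blast
    ultimately have x: "x \<in> F" "openin X {x}"
      by auto
    then show "\<exists>x\<in>F. \<forall>U. openin X U \<longrightarrow> U \<inter> F \<noteq> {} \<longrightarrow> x \<in> U"
      using F(3)[rule_format, of "{x}"] by blast
  qed fact
  ultimately show ?thesis
    by (simp add: separation_def)
qed

text \<open>
  An irreducible closed set is determined by its part in the lowest stratum that it meets: that part
  is open in it, hence dense, and the generic point of the part is generic in the whole. The ladder
  and the spaces obtained below by adding points to a given space are well-ordered piles of strata
  that are discrete or copies of the given space.
\<close>
lemma separation_stratified:
  fixes rk :: "'a \<Rightarrow> 'r::wellorder"
  assumes init: "\<And>r. openin X {x \<in> topspace X. rk x \<le> r}"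
    and strata: "\<And>r. separation t s (subtopology X {x. rk x = r})"
  shows "separation t s X"
proof -
  have t0: "t0_space X" if t0: "\<And>r. t0_space (subtopology X {x. rk x = r})"
    unfolding t0_space_def
  proof (intro ballI impI)
    have split: "\<exists>U. openin X U \<and> (x \<notin> U \<longleftrightarrow> y \<in> U)"
      if "x \<in> topspace X" "y \<in> topspace X" "rk x < rk y" for x y
    proof -
      have "x \<in> {z \<in> topspace X. rk z \<le> rk x}" "y \<notin> {z \<in> topspace X. rk z \<le> rk x}"
        using that by auto
      with init[of "rk x"] show ?thesis
        by blast
    qed
    fix x y
    assume xy: "x \<in> topspace X" "y \<in> topspace X" "x \<noteq> y"
    consider "rk x < rk y" | "rk y < rk x" | "rk x = rk y"
      by (meson linorder_less_linear)
    then show "\<exists>U. openin X U \<and> (x \<notin> U \<longleftrightarrow> y \<in> U)"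
    proof cases
      case 1
      with split xy show ?thesis by blast
    next
      case 2
      with split[of y x] xy show ?thesis by blast
    next
      case 3
      let ?L = "subtopology X {z. rk z = rk x}"
      have "x \<in> topspace ?L" "y \<in> topspace ?L"
        using xy 3 by auto
      then obtain U where "openin ?L U" "x \<notin> U \<longleftrightarrow> y \<in> U"
        using t0[of "rk x"] xy(3) unfolding t0_space_def by metis
      with 3 show ?thesis
        unfolding openin_subtopology by auto
    qed
  qed
  have sober: "sober_space X" if sob: "\<And>r. sober_space (subtopology X {x. rk x = r})"
    unfolding sober_space_iff
  proof (intro conjI allI impI; (elim conjE)?)
    show "t0_space X"
      using t0 sob sober_imp_t0_space by blast
  next
    fix F
    assume F: "closedin X F" "F \<noteq> {}"
      "\<forall>U V. openin X U \<longrightarrow> openin X V \<longrightarrow> F \<inter> U \<noteq> {} \<longrightarrow> F \<inter> V \<noteq> {} \<longrightarrow> F \<inter> U \<inter> V \<noteq> {}"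
    define r where "r = (LEAST r. r \<in> rk ` F)"
    have r: "r \<in> rk ` F" "\<And>x. x \<in> F \<Longrightarrow> r \<le> rk x"
      unfolding r_def using F(2) by (auto intro: LeastI Least_le)
    \<comment> \<open>\<open>F\<close> meets the open initial segment \<open>?I\<close> exactly in its lowest stratum.\<close>
    let ?I = "{x \<in> topspace X. rk x \<le> r}"
    let ?L = "subtopology X {x. rk x = r}"
    let ?G = "{x. rk x = r} \<inter> F"
    have FX: "F \<subseteq> topspace X"
      using F(1) closedin_subset by blast
    have G: "?G = F \<inter> ?I"
      using FX r(2) by force
    have ne: "?G \<noteq> {}"
      using r(1) by blast
    have "closedin ?L ?G"
      using F(1) by (auto simp: closedin_subtopology)
    moreover have "?G \<inter> U \<inter> V \<noteq> {}"
      if U: "openin ?L U" "?G \<inter> U \<noteq> {}" and V: "openin ?L V" "?G \<inter> V \<noteq> {}" for U V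
    proof -
      obtain U' V' where U': "openin X U'" "U = U' \<inter> {x. rk x = r}"
        and V': "openin X V'" "V = V' \<inter> {x. rk x = r}"
        using U V unfolding openin_subtopology by blast
      have "F \<inter> (U' \<inter> ?I) \<noteq> {}" "F \<inter> (V' \<inter> ?I) \<noteq> {}"
        using U(2) V(2) U'(2) V'(2) G by blast+
      then have "F \<inter> (U' \<inter> ?I) \<inter> (V' \<inter> ?I) \<noteq> {}"
        using F(3) U'(1) V'(1) init[of r] by (simp add: openin_Int)
      then show ?thesis
        using G U'(2) V'(2) by blast
    qed
    ultimately have "\<exists>x\<in>?G. \<forall>U. openin ?L U \<longrightarrow> U \<inter> ?G \<noteq> {} \<longrightarrow> x \<in> U"
      by (intro sob[of r, unfolded sober_space_iff, THEN conjunct2, rule_format] conjI allI impI ne)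
    then obtain x where x: "x \<in> ?G" "\<And>U. openin ?L U \<Longrightarrow> U \<inter> ?G \<noteq> {} \<Longrightarrow> x \<in> U"
      by blast
    have "x \<in> U" if U: "openin X U" "U \<inter> F \<noteq> {}" for U
    proof -
      have "F \<inter> U \<inter> ?I \<noteq> {}"
        using F(3) U init[of r] ne G by (metis Int_commute)
      then have "(U \<inter> {x. rk x = r}) \<inter> ?G \<noteq> {}"
        using G by blast
      moreover have "openin ?L (U \<inter> {x. rk x = r})"
        using U(1) by (auto simp: openin_subtopology)
      ultimately show ?thesis
        using x(2) by blast
    qed
    with x(1) show "\<exists>x\<in>F. \<forall>U. openin X U \<longrightarrow> U \<inter> F \<noteq> {} \<longrightarrow> x \<in> U"
      by blast
  qed
  show ?thesis
    using strata t0 sober unfolding separation_def by blast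
qed

section \<open>The ladder\<close>

abbreviation continuous_open_map :: "'a topology \<Rightarrow> 'b topology \<Rightarrow> ('a \<Rightarrow> 'b) \<Rightarrow> bool" where
  "continuous_open_map X Y f \<equiv> continuous_map X Y f \<and> open_map X Y f"

text \<open>
  The ladder has infinitely many levels of two points each. The least neighbourhood of a point consists
  of that point and all points of the levels before it, and \<open>Floor\<close> comes after all levels. Two
  properties make it useful. It contains a copy of itself below its first level, the image of
  \<open>descend\<close>. And the two points of the first level, taken in both coordinates, give four isolated
  colours.
\<close>
datatype rung = Rung nat bool | Floor

fun depth :: "rung \<Rightarrow> enat" where
  "depth (Rung n i) = enat n"
| "depth Floor = \<infinity>"

fun descend :: "rung \<Rightarrow> rung" where
  "descend (Rung n i) = Rung (Suc n) i"
| "descend Floor = Floor"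

definition ladder :: "rung topology" where
  "ladder = topology (\<lambda>U. \<forall>x\<in>U. \<forall>y. depth y < depth x \<longrightarrow> y \<in> U)"

lemma openin_ladder:
  "openin ladder U \<longleftrightarrow> (\<forall>x\<in>U. \<forall>y. depth y < depth x \<longrightarrow> y \<in> U)"
proof -
  have "istopology (\<lambda>U. \<forall>x\<in>U. \<forall>y. depth y < depth x \<longrightarrow> y \<in> U)"
    unfolding istopology_def by blast
  then show ?thesis
    by (simp add: ladder_def)
qed

lemma topspace_ladder [simp]: "topspace ladder = UNIV"
  using openin_subset[of ladder UNIV] by (auto simp: openin_ladder)

lemma openin_ladder_Floor: "openin ladder U \<Longrightarrow> Floor \<in> U \<Longrightarrow> U = UNIV"
proof -
  assume U: "openin ladder U" "Floor \<in> U"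
  have "x \<in> U" for x
    using U by (cases x) (force simp: openin_ladder)+
  then show "U = UNIV" by blast
qed

lemma separation_ladder: "separation t s ladder"
proof (rule separation_stratified)
  show "openin ladder {x \<in> topspace ladder. depth x \<le> r}" for r
    by (force simp: openin_ladder)
  show "separation t s (subtopology ladder {x. depth x = r})" for r
  proof (rule separation_discrete)
    fix x
    assume "x \<in> topspace (subtopology ladder {x. depth x = r})"
    then have "{x} = {y. y = x \<or> depth y < depth x} \<inter> {x. depth x = r}"
      by auto
    moreover have "openin ladder {y. y = x \<or> depth y < depth x}"
      by (auto simp: openin_ladder)
    ultimately show "openin (subtopology ladder {x. depth x = r}) {x}"
      unfolding openin_subtopology by blast
  qed
qed

lemma depth_descend [simp]: "depth (descend x) = eSuc (depth x)"
  by (cases x) (simp_all add: eSuc_enat)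

lemma inj_descend: "inj descend"
proof (rule injI)
  show "x = y" if "descend x = descend y" for x y
    using that by (cases x; cases y) auto
qed

lemma rung_cases_descend: obtains i where "x = Rung 0 i" | y where "x = descend y"
proof (cases x)
  case (Rung n i)
  then show thesis
    using that(1)[of i] that(2)[of "Rung (n - 1) i"] by (cases n) auto
next
  case Floor
  then show thesis
    using that(2)[of Floor] by simp
qed

lemma openin_ladder_vimage_descend: "openin ladder U \<Longrightarrow> openin ladder (descend -` U)"
  unfolding openin_ladder by (metis depth_descend eSuc_mono vimageD vimageI)

lemma openin_ladder_image_descend:
  assumes "openin ladder U"
  shows "openin ladder (range (Rung 0) \<union> descend ` U)"
  unfolding openin_ladder
proof (intro ballI allI impI)
  fix x y
  assume x: "x \<in> range (Rung 0) \<union> descend ` U" and less: "depth y < depth x"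
  from x consider "x \<in> range (Rung 0)" | z where "z \<in> U" "x = descend z"
    by blast
  then show "y \<in> range (Rung 0) \<union> descend ` U"
  proof cases
    case 1
    with less show ?thesis
      by (auto simp flip: zero_enat_def)
  next
    case 2
    show ?thesis
    proof (cases y rule: rung_cases_descend)
      case (2 y')
      with less \<open>x = descend z\<close> have "y' \<in> U"
        using \<open>z \<in> U\<close> assms by (auto simp: openin_ladder)
      with 2 show ?thesis by blast
    qed blast
  qed
qed


section \<open>Adding points below a space\<close>

text \<open>
  The test space built from \<open>P\<close>. The points \<open>Top i j\<close> are isolated and carry the four colours of level
  zero. The points \<open>Base x\<close> form a closed copy of \<open>P\<close> inside the subspace of tops and base points;
  their neighbourhoods contain the two diagonal tops, which already give both colours in each
  coordinate. The point \<open>Mark x\<close> lies directly below \<open>Base x\<close> and differs from it only by seeing the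
  further top \<open>Top False True\<close>. The marks form a discrete subspace, so a set of marks can be chosen
  freely, which is not so for the points of \<open>P\<close>.
\<close>
datatype 'a node = Top bool bool | Base 'a | Mark 'a

definition marked_copy :: "'a topology \<Rightarrow> 'a node topology" where
  "marked_copy P = topology (\<lambda>U. openin P (Base -` U) \<and>
     (\<forall>x. Base x \<in> U \<longrightarrow> (\<forall>i. Top i i \<in> U)) \<and>
     (\<forall>x. Mark x \<in> U \<longrightarrow> Base x \<in> U \<and> Top False True \<in> U))"

lemma openin_marked_copy:
  "openin (marked_copy P) U \<longleftrightarrow> openin P (Base -` U) \<and>
     (\<forall>x. Base x \<in> U \<longrightarrow> (\<forall>i. Top i i \<in> U)) \<and>
     (\<forall>x. Mark x \<in> U \<longrightarrow> Base x \<in> U \<and> Top False True \<in> U)"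
proof -
  have "istopology (\<lambda>U. openin P (Base -` U) \<and>
     (\<forall>x. Base x \<in> U \<longrightarrow> (\<forall>i. Top i i \<in> U)) \<and>
     (\<forall>x. Mark x \<in> U \<longrightarrow> Base x \<in> U \<and> Top False True \<in> U))"
    unfolding istopology_def
  proof (intro conjI allI impI)
    fix \<K> :: "'a node set set"
    assume K: "\<forall>K\<in>\<K>. openin P (Base -` K) \<and>
     (\<forall>x. Base x \<in> K \<longrightarrow> (\<forall>i. Top i i \<in> K)) \<and>
     (\<forall>x. Mark x \<in> K \<longrightarrow> Base x \<in> K \<and> Top False True \<in> K)"
    show "openin P (Base -` \<Union>\<K>)"
      unfolding vimage_Union using K by (intro openin_Union) auto
  qed (auto simp: vimage_Int)
  then show ?thesis
    unfolding marked_copy_def by simp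
qed

lemma topspace_marked_copy:
  "topspace (marked_copy P) = {Top i j | i j. True} \<union> Base ` topspace P \<union> Mark ` topspace P"
    (is "_ = ?N")
proof
  show "topspace (marked_copy P) \<subseteq> ?N"
  proof
    fix n
    assume n: "n \<in> topspace (marked_copy P)"
    have U: "openin (marked_copy P) (topspace (marked_copy P))"
      by blast
    then have "Base -` topspace (marked_copy P) \<subseteq> topspace P"
      unfolding openin_marked_copy using openin_subset by blast
    moreover have "Base x \<in> topspace (marked_copy P)" if "Mark x \<in> topspace (marked_copy P)" for x
      using U that unfolding openin_marked_copy by blast
    ultimately show "n \<in> ?N"
      using n by (cases n) blast+
  qed
  have "Base -` ?N = topspace P"
    by auto
  then have "openin (marked_copy P) ?N"
    unfolding openin_marked_copy by auto
  then show "?N \<subseteq> topspace (marked_copy P)"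
    by (rule openin_subset)
qed

lemma in_topspace_marked_copy [simp]:
  "Top i j \<in> topspace (marked_copy P)"
  "Base x \<in> topspace (marked_copy P) \<longleftrightarrow> x \<in> topspace P"
  "Mark x \<in> topspace (marked_copy P) \<longleftrightarrow> x \<in> topspace P"
  by (auto simp: topspace_marked_copy)

lemma separation_marked_copy:
  assumes "separation t s P"
  shows "separation t s (marked_copy P)"
proof -
  define rk :: "'a node \<Rightarrow> nat" where
    "rk n = (case n of Top i j \<Rightarrow> 0 | Base x \<Rightarrow> 1 | Mark x \<Rightarrow> 2)" for n
  have [simp]: "rk (Top i j) = 0" "rk (Base x) = 1" "rk (Mark x) = 2" for i j x
    by (simp_all add: rk_def)
  show ?thesis
  proof (rule separation_stratified[where rk = rk])
    show "openin (marked_copy P) {n \<in> topspace (marked_copy P). rk n \<le> r}" for r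
    proof -
      have "Base -` {n \<in> topspace (marked_copy P). rk n \<le> r} = (if r = 0 then {} else topspace P)"
        by auto
      then show ?thesis
        unfolding openin_marked_copy by auto
    qed
    fix r
    let ?L = "subtopology (marked_copy P) {n. rk n = r}"
    show "separation t s ?L"
    proof (cases "r = 1")
      case False
      show ?thesis
      proof (rule separation_discrete)
        fix n
        assume n: "n \<in> topspace ?L"
        define U where "U = insert n (if r = 0 then {} else {m \<in> topspace (marked_copy P). rk m < 2})"
        have "n = Top i j \<Longrightarrow> r = 0" "n = Mark x \<Longrightarrow> r = 2" "n \<noteq> Base x" for i j x
          using n False by auto
        then have "Base -` U = (if r = 0 then {} else topspace P)"
          by (cases n) (auto simp: U_def)
        then have "openin (marked_copy P) U"
          using n False by (cases n) (auto simp: openin_marked_copy U_def)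
        moreover have "{n} = U \<inter> {n. rk n = r}"
          using n False unfolding U_def by (cases n) auto
        ultimately show "openin ?L {n}"
          unfolding openin_subtopology by blast
      qed
    next
      case True
      have L: "topspace ?L = Base ` topspace P"
        using True by (auto simp: topspace_marked_copy)
      define h where "h = the_inv_into UNIV (Base :: 'a \<Rightarrow> 'a node)"
      have [simp]: "h (Base x) = x" for x
        unfolding h_def by (rule the_inv_into_f_f) (auto simp: inj_def)
      show ?thesis
      proof (rule separation_homeomorphic_map[OF assms])
        show "homeomorphic_map ?L P h"
        proof (rule bijective_open_imp_homeomorphic_map)
          show "continuous_map ?L P h"
            unfolding continuous_map_def
          proof (intro conjI allI impI)
            show "h \<in> topspace ?L \<rightarrow> topspace P"
              unfolding L by auto
            fix U assume U: "openin P U"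
            have "openin (marked_copy P) (range (case_prod Top) \<union> Base ` U)"
            proof -
              have "Base -` (range (case_prod Top) \<union> Base ` U) = U"
                by auto
              then show ?thesis
                unfolding openin_marked_copy using U by (auto simp: image_iff)
            qed
            moreover have "{n \<in> topspace ?L. h n \<in> U} =
                (range (case_prod Top) \<union> Base ` U) \<inter> {n. rk n = r}"
              unfolding L using openin_subset[OF U] True by auto
            ultimately show "openin ?L {n \<in> topspace ?L. h n \<in> U}"
              unfolding openin_subtopology by blast
          qed
          show "open_map ?L P h"
            unfolding open_map_def
          proof (intro allI impI)
            fix U assume "openin ?L U"
            then obtain V where V: "openin (marked_copy P) V" "U = V \<inter> {n. rk n = r}"
              unfolding openin_subtopology by blast
            have "m \<in> range Base" if "rk m = 1" for m
              using that by (cases m) auto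
            then have "h ` U = Base -` V"
              using V(2) True by (force simp: image_iff)
            then show "openin P (h ` U)"
              using V(1) unfolding openin_marked_copy by simp
          qed
          show "h ` topspace ?L = topspace P" "inj_on h (topspace ?L)"
            unfolding L by (force simp: inj_on_def)+
        qed
      qed
    qed
  qed
qed

text \<open>
  \<open>None\<close> is a new closed point, and its neighbourhoods are the sets that contain it and an open set
  around \<open>B\<close>.
\<close>
definition adjoin_below :: "'a topology \<Rightarrow> 'a set \<Rightarrow> 'a option topology" where
  "adjoin_below W B =
     topology (\<lambda>U. openin W (Some -` U) \<and> (None \<in> U \<longrightarrow> Some ` B \<subseteq> U))"

lemma openin_adjoin_below:
  "openin (adjoin_below W B) U \<longleftrightarrow> openin W (Some -` U) \<and> (None \<in> U \<longrightarrow> Some ` B \<subseteq> U)"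
proof -
  have "istopology (\<lambda>U. openin W (Some -` U) \<and> (None \<in> U \<longrightarrow> Some ` B \<subseteq> U))"
    unfolding istopology_def
  proof (intro conjI allI impI)
    fix \<K> :: "'a option set set"
    assume K: "\<forall>K\<in>\<K>. openin W (Some -` K) \<and> (None \<in> K \<longrightarrow> Some ` B \<subseteq> K)"
    show "openin W (Some -` \<Union>\<K>)"
      unfolding vimage_Union using K by (intro openin_Union) auto
  qed (auto simp: vimage_Int)
  then show ?thesis
    unfolding adjoin_below_def by simp
qed

lemma topspace_adjoin_below:
  assumes "B \<subseteq> topspace W"
  shows "topspace (adjoin_below W B) = insert None (Some ` topspace W)"
proof
  have "Some -` insert None (Some ` topspace W) = topspace W"
    by auto
  then have "openin (adjoin_below W B) (insert None (Some ` topspace W))"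
    using assms by (auto simp: openin_adjoin_below)
  then show "insert None (Some ` topspace W) \<subseteq> topspace (adjoin_below W B)"
    by (rule openin_subset)
  have "Some -` topspace (adjoin_below W B) \<subseteq> topspace W"
    using openin_topspace[of "adjoin_below W B"] openin_subset unfolding openin_adjoin_below by blast
  then show "topspace (adjoin_below W B) \<subseteq> insert None (Some ` topspace W)"
  proof (intro subsetI)
    show "n \<in> insert None (Some ` topspace W)"
      if "n \<in> topspace (adjoin_below W B)" "Some -` topspace (adjoin_below W B) \<subseteq> topspace W" for n
      using that by (cases n) auto
  qed
qed

lemma continuous_open_map_Some: "continuous_open_map W (adjoin_below W B) Some"
proof
  show "open_map W (adjoin_below W B) Some"
    by (auto simp: open_map_def openin_adjoin_below inj_vimage_image_eq)
  then have "Some ` topspace W \<subseteq> topspace (adjoin_below W B)"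
    using open_map_imp_subset_topspace by blast
  moreover have "openin W {x \<in> topspace W. Some x \<in> U}" if "openin (adjoin_below W B) U" for U
  proof -
    have "openin W (Some -` U)"
      using that by (simp add: openin_adjoin_below)
    moreover have "{x \<in> topspace W. Some x \<in> U} = Some -` U"
      using openin_subset[OF calculation] by auto
    ultimately show ?thesis by simp
  qed
  ultimately show "continuous_map W (adjoin_below W B) Some"
    unfolding continuous_map_def by blast
qed

lemma separation_adjoin_below:
  assumes W: "separation t s W" and B: "B \<subseteq> topspace W"
  shows "separation t s (adjoin_below W B)"
proof -
  define rk :: "'a option \<Rightarrow> nat" where "rk n = (case n of Some x \<Rightarrow> 0 | None \<Rightarrow> 1)" for n
  have [simp]: "rk (Some x) = 0" "rk None = 1" for x
    by (simp_all add: rk_def)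
  note top = topspace_adjoin_below[OF B]
  show ?thesis
  proof (rule separation_stratified[where rk = rk])
    show "openin (adjoin_below W B) {n \<in> topspace (adjoin_below W B). rk n \<le> r}" for r
    proof -
      have "Some -` {n \<in> topspace (adjoin_below W B). rk n \<le> r} = topspace W"
        by (auto simp: top)
      then show ?thesis
        using B unfolding openin_adjoin_below by (auto simp: top)
    qed
    fix r
    let ?L = "subtopology (adjoin_below W B) {n. rk n = r}"
    show "separation t s ?L"
    proof (cases "r = 0")
      case False
      show ?thesis
      proof (rule separation_discrete)
        fix n
        assume "n \<in> topspace ?L"
        then have "topspace ?L = {n}"
          using False by (auto simp: top)
        then show "openin ?L {n}"
          by (metis openin_topspace)
      qed
    next
      case True
      have L: "topspace ?L = Some ` topspace W"
        using True by (auto simp: top)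
      have "homeomorphic_map W ?L Some"
      proof (rule bijective_open_imp_homeomorphic_map)
        show "continuous_map W ?L Some"
          using continuous_open_map_Some[of W B] True by (auto simp: continuous_map_in_subtopology)
        show "open_map W ?L Some"
          using continuous_open_map_Some[of W B] True by (auto intro: open_map_into_subtopology)
        show "Some ` topspace W = topspace ?L"
          by (rule L[symmetric])
      qed (simp add: inj_on_def)
      then obtain g where "homeomorphic_map ?L W g"
        by (metis homeomorphic_map_maps homeomorphic_maps_sym)
      then show ?thesis
        by (rule separation_homeomorphic_map[OF W])
    qed
  qed
qed

definition ladder_colour :: "('a \<Rightarrow> rung) \<Rightarrow> (bool \<Rightarrow> bool \<Rightarrow> bool) \<Rightarrow> 'a node \<Rightarrow> rung" where
  "ladder_colour p c n =
     (case n of Top i j \<Rightarrow> Rung 0 (c i j) | Base x \<Rightarrow> descend (p x) | Mark x \<Rightarrow> descend (p x))"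

lemma ladder_colour_simps [simp]:
  "ladder_colour p c (Top i j) = Rung 0 (c i j)"
  "ladder_colour p c (Base x) = descend (p x)"
  "ladder_colour p c (Mark x) = descend (p x)"
  by (simp_all add: ladder_colour_def)

text \<open>
  An open set that meets the base contains both diagonal tops, so its image contains the whole of
  level zero, as an open set that meets the image of \<open>descend\<close> must. This is where \<open>c i i = i\<close> enters.
\<close>
lemma ladder_colour_continuous_open:
  assumes p: "continuous_open_map P ladder p" and c: "\<And>i. c i i = i"
  shows "continuous_open_map (marked_copy P) ladder (ladder_colour p c)"
proof
  let ?f = "ladder_colour p c"
  show "continuous_map (marked_copy P) ladder ?f"
    unfolding continuous_map_def
  proof (intro conjI allI impI)
    fix U assume U: "openin ladder U"
    have top: "Rung 0 i \<in> U" if "descend x \<in> U" for i x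
    proof -
      have "depth (Rung 0 i) < depth (descend x)"
        by (simp flip: zero_enat_def)
      with U that show ?thesis
        unfolding openin_ladder by blast
    qed
    have "openin P {x \<in> topspace P. p x \<in> descend -` U}"
      using p openin_ladder_vimage_descend[OF U] unfolding continuous_map_def by blast
    moreover have "Base -` {n \<in> topspace (marked_copy P). ?f n \<in> U} =
        {x \<in> topspace P. p x \<in> descend -` U}"
      by auto
    ultimately show "openin (marked_copy P) {n \<in> topspace (marked_copy P). ?f n \<in> U}"
      unfolding openin_marked_copy using top by auto
  qed simp
  show "open_map (marked_copy P) ladder ?f"
    unfolding open_map_def
  proof (intro allI impI)
    fix U assume U: "openin (marked_copy P) U"
    have V: "openin ladder (p ` (Base -` U))"
      using U p unfolding openin_marked_copy open_map_def by blast
    show "openin ladder (?f ` U)"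
    proof (cases "Base -` U = {}")
      case True
      have "n \<in> range (case_prod Top)" if "n \<in> U" for n
        using U True that by (cases n) (auto simp: openin_marked_copy)
      then have "depth (?f n) = 0" if "n \<in> U" for n
        using that by (fastforce simp: zero_enat_def)
      then show ?thesis
        by (auto simp: openin_ladder)
    next
      case False
      then have top: "Top i i \<in> U" for i
        using U by (auto simp: openin_marked_copy)
      have mark: "Base x \<in> U" if "Mark x \<in> U" for x
        using U that by (auto simp: openin_marked_copy)
      have "?f n \<in> range (Rung 0) \<union> descend ` p ` (Base -` U)" if "n \<in> U" for n
        using that mark by (cases n) auto
      moreover have "Rung 0 i \<in> ?f ` U" for i
        using top[of i] c[of i] by (intro image_eqI[of _ _ "Top i i"]) auto
      moreover have "descend (p x) \<in> ?f ` U" if "Base x \<in> U" for x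
        using that by (intro image_eqI[of _ _ "Base x"]) auto
      ultimately have "?f ` U = range (Rung 0) \<union> descend ` p ` (Base -` U)"
        by blast
      then show ?thesis
        using openin_ladder_image_descend[OF V] by simp
    qed
  qed
qed

text \<open>
  Every neighbourhood of the new point contains a point that already has the colour \<open>Floor\<close>, so
  giving the new point this colour adds nothing to the images of open sets.
\<close>
lemma continuous_open_map_adjoin_below_Floor:
  assumes f: "continuous_open_map W ladder f" and B: "B \<subseteq> topspace W" "Floor \<in> f ` B"
  shows "continuous_open_map (adjoin_below W B) ladder (case_option Floor f)"
proof
  let ?f = "case_option Floor f"
  note top = topspace_adjoin_below[OF B(1)]
  show "continuous_map (adjoin_below W B) ladder ?f"
    unfolding continuous_map_def
  proof (intro conjI allI impI)
    fix U assume U: "openin ladder U"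
    have "Some -` {n \<in> topspace (adjoin_below W B). ?f n \<in> U} = {x \<in> topspace W. f x \<in> U}"
      by (auto simp: top)
    moreover have "openin W {x \<in> topspace W. f x \<in> U}"
      using f U unfolding continuous_map_def by blast
    moreover have "Some ` B \<subseteq> {n \<in> topspace (adjoin_below W B). ?f n \<in> U}" if "Floor \<in> U"
      using openin_ladder_Floor[OF U that] B(1) by (auto simp: top)
    ultimately show "openin (adjoin_below W B) {n \<in> topspace (adjoin_below W B). ?f n \<in> U}"
      unfolding openin_adjoin_below by simp
  qed simp
  show "open_map (adjoin_below W B) ladder ?f"
    unfolding open_map_def
  proof (intro allI impI)
    fix U assume U: "openin (adjoin_below W B) U"
    have V: "openin ladder (f ` (Some -` U))"
      using U f unfolding openin_adjoin_below open_map_def by blast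
    have "?f ` U = f ` (Some -` U)"
    proof
      show "f ` (Some -` U) \<subseteq> ?f ` U"
        by force
      have "Floor \<in> f ` (Some -` U)" if "None \<in> U"
        using U that B(2) unfolding openin_adjoin_below by blast
      then show "?f ` U \<subseteq> f ` (Some -` U)"
        by (auto split: option.splits)
    qed
    with V show "openin ladder (?f ` U)"
      by simp
  qed
qed

section \<open>A product of the ladder with itself\<close>

text \<open>
  \<open>P\<close> with \<open>p\<close> and \<open>q\<close> is a product of the ladder with itself, where the ladder is not required to lie
  on the type \<open>'u\<close>. A pair of open maps to the ladder is thought of as a colouring of its domain: each
  coloured space has exactly one colour-preserving open map to \<open>P\<close>.
\<close>
locale ladder_square =
  fixes small :: "'u set \<Rightarrow> bool" and t s :: bool
    and P :: "'u topology" and p q :: "'u \<Rightarrow> rung"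
  assumes small: "smallness small"
    and small_P: "small (topspace P)"
    and sep_P: "separation t s P"
    and p: "continuous_open_map P ladder p"
    and q: "continuous_open_map P ladder q"
    and pairing_copy: "\<And>(Z :: 'u topology) f g. \<lbrakk>small (topspace Z); separation t s Z;
       continuous_open_map Z ladder f; continuous_open_map Z ladder g\<rbrakk> \<Longrightarrow>
       \<exists>h. continuous_open_map Z P h \<and> (\<forall>z\<in>topspace Z. p (h z) = f z \<and> q (h z) = g z)"
    and unique_copy: "\<And>(Z :: 'u topology) h k z. \<lbrakk>small (topspace Z); separation t s Z;
       continuous_open_map Z P h; continuous_open_map Z P k;
       \<forall>z\<in>topspace Z. p (h z) = p (k z) \<and> q (h z) = q (k z); z \<in> topspace Z\<rbrakk> \<Longrightarrow> h z = k z"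

text \<open>
  A space on another type is a legitimate test space when it is homeomorphic to a small space on \<open>'u\<close>.
\<close>
definition sized :: "('u set \<Rightarrow> bool) \<Rightarrow> 'a set \<Rightarrow> bool" where
  "sized small A \<longleftrightarrow> (\<exists>e :: 'a \<Rightarrow> 'u. inj_on e A \<and> small (e ` A))"

lemma sized_UNIV_rung:
  assumes "smallness small"
  shows "sized small (UNIV :: rung set)"
proof -
  obtain B where B: "small B" "infinite B" and sub: "\<And>A B. small A \<Longrightarrow> B \<subseteq> A \<Longrightarrow> small B"
    using assms unfolding smallness_def by blast
  then obtain c :: "nat \<Rightarrow> 'a" where c: "inj c" "range c \<subseteq> B"
    by (meson infinite_countable_subset)
  define e :: "rung \<Rightarrow> nat" where
    "e x = (case x of Rung n i \<Rightarrow> Suc (2 * n + of_bool i) | Floor \<Rightarrow> 0)" for x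
  have parity: "2 * m \<noteq> Suc (2 * n)" "Suc (2 * n) \<noteq> 2 * m" for m n :: nat
    by presburger+
  have "inj e"
  proof (rule injI)
    show "x = y" if "e x = e y" for x y
      using that parity unfolding e_def by (cases x; cases y) (auto simp: of_bool_def split: if_splits)
  qed
  then have "inj (c \<circ> e)"
    using c(1) by (rule inj_compose[rotated])
  moreover have "small (range (c \<circ> e))"
    using c(2) by (intro sub[OF B(1)]) auto
  ultimately show ?thesis
    unfolding sized_def by blast
qed

lemma homeomorphic_copy:
  fixes e :: "'a \<Rightarrow> 'u"
  assumes inj: "inj_on e (topspace Z)"
  obtains Y r where "topspace Y = e ` topspace Z"
    "homeomorphic_map Z Y e" "homeomorphic_map Y Z r"
    "\<And>z. z \<in> topspace Z \<Longrightarrow> r (e z) = z"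
proof -
  define r where "r = inv_into (topspace Z) e"
  have re: "r (e z) = z" if "z \<in> topspace Z" for z
    using that inj by (simp add: r_def)
  define L where "L U \<longleftrightarrow> U \<subseteq> e ` topspace Z \<and> openin Z (r ` U)" for U
  have L_iff: "L (e ` V) \<longleftrightarrow> openin Z V" if "V \<subseteq> topspace Z" for V
  proof -
    have "r ` e ` V = V"
      using that re by force
    then show ?thesis
      using that by (auto simp: L_def)
  qed
  have "istopology L"
    unfolding istopology_def
  proof (intro conjI allI impI)
    fix A B assume AB: "L A" "L B"
    then obtain A' B' where A: "A = e ` A'" "A' \<subseteq> topspace Z" and B: "B = e ` B'" "B' \<subseteq> topspace Z"
      unfolding L_def subset_image_iff by blast
    then have "openin Z (A' \<inter> B')"
      using AB L_iff by blast
    moreover have "A \<inter> B = e ` (A' \<inter> B')"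
      using A B inj by (simp add: inj_on_image_Int)
    ultimately show "L (A \<inter> B)"
      using L_iff[of "A' \<inter> B'"] A by auto
  next
    fix \<K> assume "\<forall>K\<in>\<K>. L K"
    then have "\<Union>\<K> \<subseteq> e ` topspace Z" "openin Z (\<Union>((`) r ` \<K>))"
      unfolding L_def by (blast, intro openin_Union) auto
    then show "L (\<Union>\<K>)"
      unfolding L_def by (simp add: image_Union)
  qed
  then have Y: "openin (topology L) = L"
    by simp
  have top: "topspace (topology L) = e ` topspace Z"
  proof
    show "topspace (topology L) \<subseteq> e ` topspace Z"
      unfolding topspace_def Y L_def by blast
    show "e ` topspace Z \<subseteq> topspace (topology L)"
      using openin_subset[of "topology L" "e ` topspace Z"] L_iff[of "topspace Z"] Y by simp
  qed
  have e: "homeomorphic_map Z (topology L) e"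
  proof (rule bijective_open_imp_homeomorphic_map)
    show "continuous_map Z (topology L) e"
      unfolding continuous_map_def Y
    proof (intro conjI allI impI)
      fix U assume "L U"
      then obtain V where V: "V \<subseteq> topspace Z" "U = e ` V"
        unfolding L_def subset_image_iff by blast
      then have "{z \<in> topspace Z. e z \<in> U} = V"
        using inj by (auto simp: inj_on_def)
      with \<open>L U\<close> show "openin Z {z \<in> topspace Z. e z \<in> U}"
        using L_iff[OF V(1)] V(2) by simp
    qed (simp add: top)
    show "open_map Z (topology L) e"
      unfolding open_map_def Y using L_iff openin_subset by metis
    show "e ` topspace Z = topspace (topology L)"
      by (simp add: top)
    show "inj_on e (topspace Z)"
      by (rule inj)
  qed
  moreover have "homeomorphic_map (topology L) Z r"
  proof (rule bijective_open_imp_homeomorphic_map)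
    show "continuous_map (topology L) Z r"
      unfolding continuous_map_def Y
    proof (intro conjI allI impI)
      show "r \<in> topspace (topology L) \<rightarrow> topspace Z"
        using re by (auto simp: top)
      fix U assume U: "openin Z U"
      then have "{y \<in> topspace (topology L). r y \<in> U} = e ` U"
        using re openin_subset[OF U] by (auto simp: top)
      with U show "L {y \<in> topspace (topology L). r y \<in> U}"
        using L_iff openin_subset by metis
    qed
    show "open_map (topology L) Z r"
      unfolding open_map_def Y L_def by blast
    show "r ` topspace (topology L) = topspace Z" "inj_on r (topspace (topology L))"
      unfolding top using re by (force simp: inj_on_def)+
  qed
  ultimately show thesis
    using that top re by blast
qed

lemma continuous_open_map_compose:
  "continuous_open_map X Y f \<Longrightarrow> continuous_open_map Y Z g \<Longrightarrow> continuous_open_map X Z (\<lambda>x. g (f x))"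
  using continuous_map_compose[of X Y f Z g] open_map_compose[of X Y f Z g]
  by (simp add: comp_def)

lemma homeomorphic_imp_continuous_open_map:
  "homeomorphic_map X Y f \<Longrightarrow> continuous_open_map X Y f"
  by (simp add: homeomorphic_imp_continuous_map homeomorphic_imp_open_map)

context ladder_square
begin

lemma pairing:
  fixes Z :: "'z topology"
  assumes "sized small (topspace Z)" "separation t s Z"
    and f: "continuous_open_map Z ladder f" and g: "continuous_open_map Z ladder g"
  obtains h where "continuous_open_map Z P h"
    "\<And>z. z \<in> topspace Z \<Longrightarrow> p (h z) = f z" "\<And>z. z \<in> topspace Z \<Longrightarrow> q (h z) = g z"
proof -
  obtain e :: "'z \<Rightarrow> 'u" where e: "inj_on e (topspace Z)" "small (e ` topspace Z)"
    using assms(1) unfolding sized_def by blast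
  obtain Y r where Y: "topspace Y = e ` topspace Z"
    "homeomorphic_map Z Y e" "homeomorphic_map Y Z r"
    and re: "\<And>z. z \<in> topspace Z \<Longrightarrow> r (e z) = z"
    using homeomorphic_copy[OF e(1)] by blast
  have "continuous_open_map Y ladder (\<lambda>y. f (r y))" "continuous_open_map Y ladder (\<lambda>y. g (r y))"
    by (rule continuous_open_map_compose[OF homeomorphic_imp_continuous_open_map[OF Y(3)] f]
             continuous_open_map_compose[OF homeomorphic_imp_continuous_open_map[OF Y(3)] g])+
  then obtain h where h: "continuous_open_map Y P h"
    "\<forall>y\<in>topspace Y. p (h y) = f (r y) \<and> q (h y) = g (r y)"
    using pairing_copy[of Y "\<lambda>y. f (r y)" "\<lambda>y. g (r y)"] e(2) Y(1)
      separation_homeomorphic_map[OF assms(2) Y(3)] by metis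
  show thesis
  proof (rule that)
    show "continuous_open_map Z P (\<lambda>z. h (e z))"
      using homeomorphic_imp_continuous_open_map[OF Y(2)] h(1) by (rule continuous_open_map_compose)
    show "p (h (e z)) = f z" "q (h (e z)) = g z" if "z \<in> topspace Z" for z
      using that h(2) Y(1) re by auto
  qed
qed

lemma unique:
  fixes Z :: "'z topology"
  assumes "sized small (topspace Z)" "separation t s Z"
    and h: "continuous_open_map Z P h" and k: "continuous_open_map Z P k"
    and eq: "\<And>z. z \<in> topspace Z \<Longrightarrow> p (h z) = p (k z)" "\<And>z. z \<in> topspace Z \<Longrightarrow> q (h z) = q (k z)"
    and z: "z \<in> topspace Z"
  shows "h z = k z"
proof -
  obtain e :: "'z \<Rightarrow> 'u" where e: "inj_on e (topspace Z)" "small (e ` topspace Z)"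
    using assms(1) unfolding sized_def by blast
  obtain Y r where Y: "topspace Y = e ` topspace Z"
    "homeomorphic_map Z Y e" "homeomorphic_map Y Z r"
    and re: "\<And>z. z \<in> topspace Z \<Longrightarrow> r (e z) = z"
    using homeomorphic_copy[OF e(1)] by blast
  have "continuous_open_map Y P (\<lambda>y. h (r y))" "continuous_open_map Y P (\<lambda>y. k (r y))"
    by (rule continuous_open_map_compose[OF homeomorphic_imp_continuous_open_map[OF Y(3)] h]
             continuous_open_map_compose[OF homeomorphic_imp_continuous_open_map[OF Y(3)] k])+
  moreover have "\<forall>y\<in>topspace Y. p (h (r y)) = p (k (r y)) \<and> q (h (r y)) = q (k (r y))"
    using eq Y(1) re by auto
  ultimately have "h (r (e z)) = k (r (e z))"
    using unique_copy[of Y "\<lambda>y. h (r y)" "\<lambda>y. k (r y)" "e z"] e(2) Y(1) z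
      separation_homeomorphic_map[OF assms(2) Y(3)] by auto
  with z re show ?thesis by simp
qed

lemma small_subset: "small A \<Longrightarrow> B \<subseteq> A \<Longrightarrow> small B"
  using small unfolding smallness_def by blast

lemma sized_subset: "sized small A \<Longrightarrow> B \<subseteq> A \<Longrightarrow> sized small B"
  unfolding sized_def by (meson image_mono inj_on_subset small_subset)

lemma sized_small: "small A \<Longrightarrow> sized small A"
  unfolding sized_def by (intro exI[of _ id]) simp

lemma infinite_small_nat:
  obtains A and c :: "nat \<Rightarrow> 'u" where "small A" "infinite A" "inj c" "range c \<subseteq> A" "topspace P \<lesssim> A"
proof -
  obtain A where A: "small A" "infinite A" "topspace P \<lesssim> A"
  proof (cases "finite (topspace P)")
    case True
    obtain A where "small A" "infinite A"
      using small unfolding smallness_def by blast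
    with True that show thesis
      by (meson finite_lepoll_infinite)
  next
    case False
    with small_P that show thesis
      by (meson lepoll_refl)
  qed
  then obtain c :: "nat \<Rightarrow> 'u" where "inj c" "range c \<subseteq> A"
    by (meson infinite_countable_subset)
  with A that show thesis
    by blast
qed

lemma sized_rung: "sized small (A :: rung set)"
  using sized_UNIV_rung[OF small] by (rule sized_subset) simp

text \<open>
  The test spaces consist of two copies of \<open>P\<close> and five more points. They embed into \<open>A \<times> A\<close> for an
  infinite small set \<open>A\<close> into which \<open>P\<close> embeds, and \<open>A \<times> A\<close> has the cardinality of \<open>A\<close>.
\<close>
lemma sized_node_option:
  "sized small {n :: 'u node option. \<forall>x. n = Some (Base x) \<or> n = Some (Mark x) \<longrightarrow> x \<in> topspace P}"
    (is "sized small ?N")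
proof -
  obtain A and c :: "nat \<Rightarrow> 'u" where A: "small A" "infinite A" "inj c" "range c \<subseteq> A" "topspace P \<lesssim> A"
    using infinite_small_nat by blast
  obtain d where d: "inj_on d (topspace P)" "d ` topspace P \<subseteq> A"
    using A(5) unfolding lepoll_def by blast
  \<comment> \<open>The first coordinate is a tag, the second the point that is tagged.\<close>
  define e where "e n = (case n of None \<Rightarrow> (c 0, c 0)
      | Some (Top i j) \<Rightarrow> (c (1 + of_bool i), c (of_bool j))
      | Some (Base x) \<Rightarrow> (c 3, d x)
      | Some (Mark x) \<Rightarrow> (c 4, d x))" for n
  have "inj_on e ?N"
  proof (rule inj_onI)
    fix m n assume "m \<in> ?N" "n \<in> ?N" "e m = e n"
    then show "m = n"
      using A(3) d(1) unfolding e_def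
      by (auto simp: inj_eq inj_on_eq_iff of_bool_def split: option.splits node.splits if_splits)
  qed
  moreover have "e ` ?N \<subseteq> A \<times> A"
    using A(4) d(2) unfolding e_def image_subset_iff by (auto split: option.splits node.splits)
  moreover obtain k where "inj_on k (A \<times> A)" "k ` (A \<times> A) \<subseteq> A"
    using ordIso_imp_ordLeq[OF card_of_Times_same_infinite[OF A(2)]]
    unfolding card_of_ordLeq[symmetric] by blast
  ultimately have "inj_on (k \<circ> e) ?N" "(k \<circ> e) ` ?N \<subseteq> A"
    by (auto simp: image_subset_iff intro!: comp_inj_on elim!: inj_on_subset)
  then show ?thesis
    unfolding sized_def using small_subset[OF A(1)] by blast
qed

lemma sized_inj_image:
  assumes "sized small (f ` A)" "inj_on f A"
  shows "sized small A"
proof -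
  obtain e where "inj_on e (f ` A)" "small (e ` f ` A)"
    using assms(1) unfolding sized_def by blast
  then have "inj_on (e \<circ> f) A" "small ((e \<circ> f) ` A)"
    using assms(2) by (auto intro: comp_inj_on simp: image_comp)
  then show ?thesis
    unfolding sized_def by blast
qed

lemma sized_marked_copy: "sized small (topspace (marked_copy P))"
  by (rule sized_inj_image[where f = Some], rule sized_subset[OF sized_node_option])
    (auto simp: inj_on_def)

lemma endomap_is_identity:
  assumes "continuous_open_map P P h" "\<And>x. x \<in> topspace P \<Longrightarrow> p (h x) = p x"
    "\<And>x. x \<in> topspace P \<Longrightarrow> q (h x) = q x" "x \<in> topspace P"
  shows "h x = x"
  by (rule unique[OF sized_small[OF small_P] sep_P assms(1) _ _ _ assms(4), of "\<lambda>x. x"])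
    (use assms in \<open>auto simp: open_map_def\<close>)

text \<open>
  Exchanging two indistinguishable points is an open map of \<open>P\<close> to itself. It preserves colours
  because the ladder is \<open>T\<^sub>0\<close>, so it is the identity. Hence \<open>P\<close> is \<open>T\<^sub>0\<close> even when the category
  does not ask for it.
\<close>
lemma indistinguishable_points_equal:
  assumes x: "x \<in> topspace P" and y: "y \<in> topspace P"
    and eq: "\<And>U. openin P U \<Longrightarrow> x \<in> U \<longleftrightarrow> y \<in> U"
  shows "x = y"
proof -
  define h where "h = Transposition.transpose x y"
  have same: "r x = r y" if r: "continuous_open_map P ladder r" for r
  proof (rule ccontr)
    assume "r x \<noteq> r y"
    moreover have "t0_space ladder"
      using separation_ladder[of True False] by (simp add: separation_def)
    ultimately obtain U where U: "openin ladder U" "r x \<notin> U \<longleftrightarrow> r y \<in> U"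
      unfolding t0_space_def by auto
    have "openin P {z \<in> topspace P. r z \<in> U}"
      using r U(1) unfolding continuous_map_def by blast
    with eq x y U(2) show False by blast
  qed
  have img: "h ` U = U" if "openin P U" for U
    using eq[OF that] unfolding h_def by (simp add: transpose_image_eq)
  have pre: "{z \<in> topspace P. h z \<in> U} = U" if "openin P U" for U
  proof -
    have "h z \<in> U \<longleftrightarrow> z \<in> U" for z
      using eq[OF that] by (simp add: h_def Transposition.transpose_def)
    then show ?thesis
      using openin_subset[OF that] by auto
  qed
  have "h ` topspace P = topspace P"
    by (rule img) simp
  then have "continuous_open_map P P h"
    unfolding continuous_map_def open_map_def using pre img by auto
  then have "h x = x"
    by (rule endomap_is_identity) (use same[OF p] same[OF q] x in \<open>auto simp: h_def Transposition.transpose_def\<close>)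
  then show "x = y"
    by (simp add: h_def)
qed

text \<open>
  The diagonal of the ladder factors through \<open>P\<close>.
\<close>
lemma Floor_in_image: "\<exists>x\<in>topspace P. p x = Floor" "\<exists>x\<in>topspace P. q x = Floor"
proof -
  have "continuous_open_map ladder ladder (\<lambda>x. x)"
    by (simp add: open_map_def)
  then obtain h where h: "continuous_open_map ladder P h" "p (h Floor) = Floor" "q (h Floor) = Floor"
    using pairing[OF sized_rung separation_ladder] by (metis UNIV_I topspace_ladder)
  have "h Floor \<in> topspace P"
    using h(1) by (auto simp: continuous_map_def)
  with h show "\<exists>x\<in>topspace P. p x = Floor" "\<exists>x\<in>topspace P. q x = Floor"
    by blast+
qed

end

section \<open>The diagonal argument\<close>

text \<open>
  The marked copy is coloured by \<open>p\<close> and \<open>q\<close>, shifted down by one level, and \<open>h\<close> is its map to \<open>P\<close>. The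
  lemmas up to \<open>inj_on_h_Mark\<close> show that \<open>h\<close> identifies no two marks and no mark with another node.
\<close>
locale ladder_square_marked = ladder_square small t s P p q
  for small :: "'u set \<Rightarrow> bool" and t s P p q +
  fixes h :: "'u node \<Rightarrow> 'u"
  assumes h: "continuous_open_map (marked_copy P) P h"
    and p_h: "\<And>n. n \<in> topspace (marked_copy P) \<Longrightarrow> p (h n) = ladder_colour p (\<lambda>i j. i) n"
    and q_h: "\<And>n. n \<in> topspace (marked_copy P) \<Longrightarrow> q (h n) = ladder_colour q (\<lambda>i j. j) n"
begin

lemma h_in_topspace: "n \<in> topspace (marked_copy P) \<Longrightarrow> h n \<in> topspace P"
  using h by (auto simp: continuous_map_def)

text \<open>
  \<open>h\<close> behaves like a bisimulation: what one of two identified points can see near itself, the other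
  can see too, up to \<open>h\<close>.
\<close>
lemma nbhd_image:
  assumes "openin (marked_copy P) U" "m \<in> U" "n \<in> topspace (marked_copy P)" "h m = h n"
  shows "\<exists>W. openin (marked_copy P) W \<and> n \<in> W \<and> h ` W \<subseteq> h ` U"
proof (intro exI conjI)
  have "openin P (h ` U)"
    using h assms(1) by (simp add: open_map_def)
  then show "openin (marked_copy P) {k \<in> topspace (marked_copy P). h k \<in> h ` U}"
    using h by (simp add: continuous_map_def)
  show "n \<in> {k \<in> topspace (marked_copy P). h k \<in> h ` U}"
    using assms by (metis (mono_tags, lifting) imageI mem_Collect_eq)
qed auto

lemma descend_neq_Rung_0 [simp]: "descend x \<noteq> Rung 0 i" "Rung 0 i \<noteq> descend x"
  by (cases x; simp)+

lemma h_eq_Top_iff: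
  assumes "n \<in> topspace (marked_copy P)"
  shows "h n = h (Top i j) \<longleftrightarrow> n = Top i j"
proof
  assume "h n = h (Top i j)"
  then have "ladder_colour p (\<lambda>i j. i) n = Rung 0 i" "ladder_colour q (\<lambda>i j. j) n = Rung 0 j"
    using p_h[OF assms] q_h[OF assms] p_h[of "Top i j"] q_h[of "Top i j"] by auto
  then show "n = Top i j"
    by (cases n) auto
qed simp

lemma openin_Base_copy:
  assumes "openin P V"
  shows "openin (marked_copy P) (range (\<lambda>i. Top i i) \<union> Base ` V)"
proof -
  have "Base -` (range (\<lambda>i. Top i i) \<union> Base ` V) = V"
    by auto
  with assms show ?thesis
    by (auto simp: openin_marked_copy)
qed

lemma openin_Mark_copy:
  assumes "openin P V" "M \<subseteq> V"
  shows "openin (marked_copy P) (insert (Top False True) (range (\<lambda>i. Top i i)) \<union> Base ` V \<union> Mark ` M)"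
proof -
  have "Base -` (insert (Top False True) (range (\<lambda>i. Top i i)) \<union> Base ` V \<union> Mark ` M) = V"
    by auto
  with assms show ?thesis
    by (auto simp: openin_marked_copy)
qed

text \<open>
  A mark sees \<open>Top False True\<close> in each of its neighbourhoods; the base points and diagonal tops form an
  open set that does not contain it, and no other node has its colour.
\<close>
lemma h_Mark_neq_Base:
  assumes x: "x \<in> topspace P" and y: "y \<in> topspace P"
  shows "h (Mark x) \<noteq> h (Base y)"
proof
  assume "h (Mark x) = h (Base y)"
  then obtain W where W: "openin (marked_copy P) W" "Mark x \<in> W"
    "h ` W \<subseteq> h ` (range (\<lambda>i. Top i i) \<union> Base ` topspace P)"
    using nbhd_image[OF openin_Base_copy[OF openin_topspace], of "Base y" "Mark x"] x y by auto
  then have "Top False True \<in> W"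
    by (auto simp: openin_marked_copy)
  obtain n where "h (Top False True) = h n" "n \<in> range (\<lambda>i. Top i i) \<union> Base ` topspace P"
    by (rule imageE[OF subsetD[OF W(3) imageI[OF \<open>Top False True \<in> W\<close>]]])
  then show False
    using h_eq_Top_iff[of n False True] by auto
qed

lemma continuous_map_Base: "continuous_map P (marked_copy P) Base"
  unfolding continuous_map_def
proof (intro conjI allI impI)
  fix U assume "openin (marked_copy P) U"
  then have U: "openin P (Base -` U)"
    by (simp add: openin_marked_copy)
  then have "{x \<in> topspace P. Base x \<in> U} = Base -` U"
    using openin_subset by auto
  with U show "openin P {x \<in> topspace P. Base x \<in> U}"
    by simp
qed auto

text \<open>
  The image \<open>E\<close> of the base is locally closed in \<open>P\<close>: the part of an open set whose colours lie in the
  image of \<open>descend\<close>. So \<open>E\<close> is an object of the category, and undoing the shift colours it. The map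
  \<open>k\<close> from \<open>E\<close> to \<open>P\<close> obtained in this way makes \<open>P \<rightarrow> E \<rightarrow> P\<close> a colour-preserving open map, hence the
  identity.
\<close>
lemma inj_on_h_Base:
  assumes xy: "x \<in> topspace P" "y \<in> topspace P" and eq: "h (Base x) = h (Base y)"
  shows "x = y"
proof -
  define N where "N = range (\<lambda>i. Top i i) \<union> Base ` topspace P"
  define C where "C = {e \<in> topspace P. p e \<in> range descend}"
  define E where "E = subtopology P (C \<inter> h ` N)"
  define a where "a = inv descend"
  have a [simp]: "a (descend r) = r" for r
    by (simp add: a_def inj_descend)
  have img: "C \<inter> h ` N = (\<lambda>x. h (Base x)) ` topspace P"
  proof
    show "C \<inter> h ` N \<subseteq> (\<lambda>x. h (Base x)) ` topspace P"
      using p_h by (auto simp: C_def N_def)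
    show "(\<lambda>x. h (Base x)) ` topspace P \<subseteq> C \<inter> h ` N"
      using p_h h_in_topspace by (auto simp: C_def N_def)
  qed
  have topE: "topspace E = (\<lambda>x. h (Base x)) ` topspace P"
    using img unfolding E_def by (auto simp: C_def)
  have C: "closedin P C"
  proof -
    have "x \<in> range (Rung 0)" if "x \<notin> range descend" for x
      using that by (cases x rule: rung_cases_descend) auto
    then have "UNIV - range descend = range (Rung 0)"
      by auto
    then have "closedin ladder (range descend)"
      using openin_ladder_image_descend[of "{}"] by (simp add: closedin_def openin_ladder)
    then show ?thesis
      using p unfolding continuous_map_closedin C_def by blast
  qed
  have "openin P (h ` N)"
    using h openin_Base_copy[OF openin_topspace] unfolding open_map_def N_def by blast
  then have sepE: "separation t s E"
    unfolding E_def using separation_subtopology_locally_closed[OF sep_P C] by blast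
  have smallE: "sized small (topspace E)"
    by (rule sized_subset[OF sized_small[OF small_P]]) (simp add: E_def)
  have hB: "continuous_map P E (\<lambda>x. h (Base x))"
  proof -
    have "continuous_map P P (\<lambda>x. h (Base x))"
      using continuous_map_compose[OF continuous_map_Base, of P h] h by (simp add: comp_def)
    then show ?thesis
      unfolding E_def using img by (auto simp: continuous_map_in_subtopology)
  qed
  have hB_open: "open_map P E (\<lambda>x. h (Base x))"
    unfolding open_map_def
  proof (intro allI impI)
    fix V assume V: "openin P V"
    have "openin P (h ` (range (\<lambda>i. Top i i) \<union> Base ` V))"
      using h openin_Base_copy[OF V] unfolding open_map_def by blast
    moreover have "(\<lambda>x. h (Base x)) ` V = h ` (range (\<lambda>i. Top i i) \<union> Base ` V) \<inter> (C \<inter> h ` N)"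
    proof
      show "(\<lambda>x. h (Base x)) ` V \<subseteq> h ` (range (\<lambda>i. Top i i) \<union> Base ` V) \<inter> (C \<inter> h ` N)"
        using openin_subset[OF V] unfolding img by auto
      show "h ` (range (\<lambda>i. Top i i) \<union> Base ` V) \<inter> (C \<inter> h ` N) \<subseteq> (\<lambda>x. h (Base x)) ` V"
      proof
        fix e assume e: "e \<in> h ` (range (\<lambda>i. Top i i) \<union> Base ` V) \<inter> (C \<inter> h ` N)"
        then obtain n where n: "n \<in> range (\<lambda>i. Top i i) \<union> Base ` V" "e = h n"
          by blast
        moreover have "p (h n) \<in> range descend"
          using e n(2) by (simp add: C_def)
        then have "n \<noteq> Top i i" for i
          using p_h[of "Top i i"] by auto
        ultimately show "e \<in> (\<lambda>x. h (Base x)) ` V"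
          by blast
      qed
    qed
    ultimately show "openin E ((\<lambda>x. h (Base x)) ` V)"
      unfolding E_def openin_subtopology by blast
  qed
  have colour: "continuous_open_map E ladder (\<lambda>e. a (r e))"
    if r: "continuous_open_map P ladder r"
      and r_h: "\<And>x. x \<in> topspace P \<Longrightarrow> r (h (Base x)) = descend (r x)" for r
  proof
    show "continuous_map E ladder (\<lambda>e. a (r e))"
      unfolding continuous_map_def
    proof (intro conjI allI impI)
      fix U assume U: "openin ladder U"
      have "openin P {e \<in> topspace P. r e \<in> range (Rung 0) \<union> descend ` U}" (is "openin P ?U")
        using r openin_ladder_image_descend[OF U] unfolding continuous_map_def by blast
      moreover have "{e \<in> topspace E. a (r e) \<in> U} = ?U \<inter> (C \<inter> h ` N)"
        unfolding topE img using r_h h_in_topspace by (auto simp: inj_descend inj_image_mem_iff)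
      ultimately show "openin E {e \<in> topspace E. a (r e) \<in> U}"
        unfolding E_def openin_subtopology by blast
    qed simp
    show "open_map E ladder (\<lambda>e. a (r e))"
      unfolding open_map_def
    proof (intro allI impI)
      fix U assume U: "openin E U"
      have "openin P {x \<in> topspace P. h (Base x) \<in> U}"
        using hB U by (simp add: continuous_map_def)
      then have "openin ladder (r ` {x \<in> topspace P. h (Base x) \<in> U})"
        using r by (simp add: open_map_def)
      moreover have "r ` {x \<in> topspace P. h (Base x) \<in> U} = (\<lambda>e. a (r e)) ` U"
        using openin_subset[OF U] r_h unfolding topE by (force simp: image_iff)
      ultimately show "openin ladder ((\<lambda>e. a (r e)) ` U)"
        by simp
    qed
  qed
  have "continuous_open_map E ladder (\<lambda>e. a (p e))"
    by (rule colour[OF p]) (use p_h in auto)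
  moreover have "continuous_open_map E ladder (\<lambda>e. a (q e))"
    by (rule colour[OF q]) (use q_h in auto)
  ultimately obtain k where k: "continuous_open_map E P k"
    "\<And>e. e \<in> topspace E \<Longrightarrow> p (k e) = a (p e)" "\<And>e. e \<in> topspace E \<Longrightarrow> q (k e) = a (q e)"
    using pairing[OF smallE sepE] by blast
  have id: "k (h (Base z)) = z" if "z \<in> topspace P" for z
  proof (rule endomap_is_identity[where h = "\<lambda>z. k (h (Base z))"])
    show "continuous_open_map P P (\<lambda>z. k (h (Base z)))"
      using conjI[OF hB hB_open] k(1) by (rule continuous_open_map_compose)
    show "p (k (h (Base x))) = p x" "q (k (h (Base x))) = q x" if "x \<in> topspace P" for x
      using that k(2,3) p_h[of "Base x"] q_h[of "Base x"] unfolding topE by auto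
  qed (rule that)
  have "x = k (h (Base x))"
    by (rule id[OF xy(1), symmetric])
  also have "\<dots> = y"
    unfolding eq by (rule id[OF xy(2)])
  finally show ?thesis .
qed

lemma inj_on_h_Mark:
  assumes x: "x \<in> topspace P" and y: "y \<in> topspace P" and eq: "h (Mark x) = h (Mark y)"
  shows "x = y"
proof (rule indistinguishable_points_equal[OF x y])
  have nbhd: "y \<in> V"
    if V: "openin P V" "x \<in> V" and y: "y \<in> topspace P" and eq: "h (Mark x) = h (Mark y)" for x y V
  proof -
    have x: "x \<in> topspace P"
      using V openin_subset by blast
    let ?U = "insert (Top False True) (range (\<lambda>i. Top i i)) \<union> Base ` V \<union> Mark ` {x}"
    have "openin (marked_copy P) ?U"
      by (rule openin_Mark_copy) (use V in auto)
    then have "\<exists>W. openin (marked_copy P) W \<and> Mark y \<in> W \<and> h ` W \<subseteq> h ` ?U"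
      by (rule nbhd_image[OF _ _ _ eq]) (simp_all add: y)
    then obtain W where W: "openin (marked_copy P) W" "Mark y \<in> W" "h ` W \<subseteq> h ` ?U"
      by blast
    then have "Base y \<in> W"
      by (auto simp: openin_marked_copy)
    obtain n where n: "h (Base y) = h n" "n \<in> ?U"
      by (rule imageE[OF subsetD[OF W(3) imageI[OF \<open>Base y \<in> W\<close>]]])
    have "n \<noteq> Top i j" for i j
      using n(1) h_eq_Top_iff[of "Base y" i j] y by auto
    moreover have "n \<noteq> Mark x"
      using n(1) h_Mark_neq_Base[OF x y] by auto
    ultimately obtain v where v: "n = Base v" "v \<in> V"
      using n(2) by blast
    then have "v = y"
      using inj_on_h_Base[of v y] n(1) openin_subset[OF V(1)] y by auto
    with v show "y \<in> V"
      by simp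
  qed
  show "x \<in> V \<longleftrightarrow> y \<in> V" if "openin P V" for V
    using nbhd[OF that _ y eq] nbhd[OF that _ x eq[symmetric]] by blast
qed

text \<open>
  That is, \<open>w\<close> lies in the closure of the singleton of \<open>h (Mark x)\<close>.
\<close>
definition decode :: "'u \<Rightarrow> 'u set" where
  "decode w = {x \<in> topspace P. \<forall>U. openin P U \<longrightarrow> w \<in> U \<longrightarrow> h (Mark x) \<in> U}"

text \<open>
  Adjoin to the marked copy a point below the whole base, the marks of \<open>S\<close> and the top that no mark
  sees. The image \<open>w\<close> of this point in \<open>P\<close> sees the marks of \<open>S\<close> by continuity, and no other marks
  because the map is open. The extra top keeps \<open>w\<close> from being the image of a mark.
\<close>
lemma decode_surj:
  assumes S: "S \<subseteq> topspace P"
  shows "\<exists>w\<in>topspace P. decode w = S"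
proof -
  define B where "B = insert (Top True False) (Base ` topspace P \<union> Mark ` S)"
  define Z where "Z = adjoin_below (marked_copy P) B"
  have B: "B \<subseteq> topspace (marked_copy P)"
    using S by (auto simp: B_def)
  have topZ: "topspace Z = insert None (Some ` topspace (marked_copy P))"
    unfolding Z_def by (rule topspace_adjoin_below[OF B])
  have smallZ: "sized small (topspace Z)"
    by (rule sized_subset[OF sized_node_option]) (auto simp: topZ)
  have sepZ: "separation t s Z"
    unfolding Z_def by (rule separation_adjoin_below[OF separation_marked_copy[OF sep_P] B])
  have colour: "continuous_open_map Z ladder (case_option Floor (ladder_colour r c))"
    if r: "continuous_open_map P ladder r" "\<exists>x\<in>topspace P. r x = Floor" and c: "\<And>i. c i i = i" for r c
    unfolding Z_def
  proof (rule continuous_open_map_adjoin_below_Floor[OF ladder_colour_continuous_open[where c = c, OF r(1) c] B])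
    obtain x where "x \<in> topspace P" "r x = Floor"
      using r(2) by blast
    then have "Base x \<in> B" "ladder_colour r c (Base x) = Floor"
      by (auto simp: B_def)
    then show "Floor \<in> ladder_colour r c ` B"
      by (metis imageI)
  qed
  obtain g where g: "continuous_open_map Z P g"
    and pg: "\<And>n. n \<in> topspace Z \<Longrightarrow> p (g n) = case_option Floor (ladder_colour p (\<lambda>i j. i)) n"
    and qg: "\<And>n. n \<in> topspace Z \<Longrightarrow> q (g n) = case_option Floor (ladder_colour q (\<lambda>i j. j)) n"
    by (rule pairing[OF smallZ sepZ colour[where c = "\<lambda>i j. i", OF p Floor_in_image(1) refl]
          colour[where c = "\<lambda>i j. j", OF q Floor_in_image(2) refl]]) (rule that; blast)
  \<comment> \<open>On the open subspace of nodes both maps preserve colours.\<close>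
  have gh: "g (Some n) = h n" if n: "n \<in> topspace (marked_copy P)" for n
  proof (rule unique[OF sized_marked_copy separation_marked_copy[OF sep_P] _ h _ _ n])
    show "continuous_open_map (marked_copy P) P (\<lambda>n. g (Some n))"
      using continuous_open_map_Some g unfolding Z_def by (rule continuous_open_map_compose)
    show "p (g (Some m)) = p (h m)" "q (g (Some m)) = q (h m)" if "m \<in> topspace (marked_copy P)" for m
      using that pg[of "Some m"] qg[of "Some m"] p_h q_h by (auto simp: topZ)
  qed
  let ?w = "g None"
  have w: "?w \<in> topspace P"
    using g by (auto simp: continuous_map_def topZ)
  have below: "h n \<in> U" if U: "openin P U" "?w \<in> U" and n: "n \<in> B" for U n
  proof -
    have "openin Z {m \<in> topspace Z. g m \<in> U}"
      using g U(1) by (simp add: continuous_map_def)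
    then have "Some n \<in> {m \<in> topspace Z. g m \<in> U}"
      using U(2) n unfolding Z_def openin_adjoin_below by (auto simp: topZ[unfolded Z_def])
    with gh B n show ?thesis
      by auto
  qed
  have w_neq_Mark: "?w \<noteq> h (Mark x)" if x: "x \<in> topspace P" for x
  proof
    assume eq: "?w = h (Mark x)"
    let ?U = "insert (Top False True) (range (\<lambda>i. Top i i)) \<union> Base ` topspace P \<union> Mark ` {x}"
    have "openin (marked_copy P) ?U"
      by (rule openin_Mark_copy) (use x in auto)
    then have "openin P (h ` ?U)"
      using h unfolding open_map_def by blast
    moreover have "?w \<in> h ` ?U"
      unfolding eq by (rule imageI) simp
    ultimately have "h (Top True False) \<in> h ` ?U"
      by (rule below) (simp add: B_def)
    then obtain n where n: "h (Top True False) = h n" "n \<in> ?U"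
      by (rule imageE)
    have nP: "n \<in> topspace (marked_copy P)"
      using n(2) x by auto
    have "n = Top True False"
      by (rule iffD1[OF h_eq_Top_iff[OF nP] n(1)[symmetric]])
    then show False
      using n(2) by auto
  qed
  have "x \<in> S" if x: "x \<in> decode ?w" for x
  proof -
    have xP: "x \<in> topspace P"
      using x by (simp add: decode_def)
    define U where "U = {Top i j | i j. True} \<union> Base ` topspace P \<union> Mark ` S"
    have "Base -` U = topspace P"
      by (auto simp: U_def)
    then have "openin (marked_copy P) U"
      using S by (auto simp: openin_marked_copy U_def)
    moreover have "Some -` insert None (Some ` U) = U"
      by auto
    ultimately have "openin Z (insert None (Some ` U))"
      unfolding Z_def openin_adjoin_below by (auto simp: B_def U_def)
    then have "openin P (g ` insert None (Some ` U))"
      using g unfolding open_map_def by blast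
    then have "h (Mark x) \<in> g ` insert None (Some ` U)"
      using x by (auto simp: decode_def)
    then obtain n where n: "n \<in> U" "h (Mark x) = g (Some n)"
      using w_neq_Mark[OF xP] by auto
    have nP: "n \<in> topspace (marked_copy P)"
      using n(1) S by (auto simp: U_def)
    with n(2) have eq: "h (Mark x) = h n"
      using gh by simp
    show "x \<in> S"
    proof (cases n)
      case (Top i j)
      with eq h_eq_Top_iff[of "Mark x" i j] xP show ?thesis by simp
    next
      case (Base y)
      with eq h_Mark_neq_Base[OF xP, of y] nP show ?thesis by simp
    next
      case (Mark y)
      with eq inj_on_h_Mark[OF xP, of y] nP n(1) show ?thesis by (auto simp: U_def)
    qed
  qed
  moreover have "x \<in> decode ?w" if "x \<in> S" for x
    using that S below[of _ "Mark x"] by (auto simp: decode_def B_def)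
  ultimately show ?thesis
    using w by blast
qed

text \<open>
  Cantor's diagonal argument: \<open>decode\<close> would map the points of \<open>P\<close> onto all sets of points of \<open>P\<close>.
\<close>
lemma marked_copy_not_coloured: False
proof -
  have "{w \<in> topspace P. w \<notin> decode w} \<subseteq> topspace P"
    by blast
  then obtain w where "w \<in> topspace P" "decode w = {w \<in> topspace P. w \<notin> decode w}"
    using decode_surj by blast
  then show False
    by blast
qed

end

lemma (in ladder_square) ladder_square_impossible: False
proof -
  obtain h where "continuous_open_map (marked_copy P) P h"
    "\<And>n. n \<in> topspace (marked_copy P) \<Longrightarrow> p (h n) = ladder_colour p (\<lambda>i j. i) n"
    "\<And>n. n \<in> topspace (marked_copy P) \<Longrightarrow> q (h n) = ladder_colour q (\<lambda>i j. j) n"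
    by (rule pairing[OF sized_marked_copy separation_marked_copy[OF sep_P]
          ladder_colour_continuous_open[where c = "\<lambda>i j. i", OF p refl]
          ladder_colour_continuous_open[where c = "\<lambda>i j. j", OF q refl]]) (rule that; blast)
  then interpret ladder_square_marked small t s P p q h
    by unfold_locales
  show False
    by (rule marked_copy_not_coloured)
qed


section \<open>No category of spaces and open maps has the square of the ladder\<close>

definition spaces :: "('u set \<Rightarrow> bool) \<Rightarrow> bool \<Rightarrow> bool \<Rightarrow> ('u topology, 'u \<Rightarrow> 'u) cat" where
  "spaces small t s = full_subcategory (TopOpen small) (separation t s)"

lemma spaces_instances:
  "TopOpen small = spaces small False False"
  "TopOpen0 small = spaces small True False"
  "SobOpen small = spaces small False True"
  by (simp_all add: spaces_def separation_def full_subcategory_def TopOpen0_def SobOpen_def TopOpen_def)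

lemma spaces_sel:
  "X \<in> Obj (spaces small t s) \<longleftrightarrow> small (topspace X) \<and> separation t s X"
  "Hom (spaces small t s) = open_maps"
  "Comp (spaces small t s) X Y Z g f = compose (topspace X) g f"
  by (simp_all add: spaces_def full_subcategory_def TopOpen_def)

lemma continuous_open_map_restrict:
  "continuous_open_map X Y f \<Longrightarrow> restrict f (topspace X) \<in> open_maps X Y"
  by (auto simp: open_maps_def elim: continuous_map_eq open_map_eq)

text \<open>
  The ladder is countable, so it has a copy \<open>X\<close> among the small spaces on \<open>'u\<close>; a product of \<open>X\<close> with
  itself, read through the homeomorphism, is an instance of \<open>ladder_square\<close>.
\<close>
lemma no_binary_products_spaces:
  fixes small :: "'u set \<Rightarrow> bool"
  assumes small: "smallness small"
  shows "\<not> has_binary_products (spaces small t s)"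
proof
  assume prods: "has_binary_products (spaces small t s)"
  obtain e :: "rung \<Rightarrow> 'u" where e: "inj e" "small (range e)"
    using sized_UNIV_rung[OF small] unfolding sized_def by blast
  obtain X d where X: "topspace X = range e" "homeomorphic_map ladder X e" "homeomorphic_map X ladder d"
    and de: "\<And>z. d (e z) = z"
    using homeomorphic_copy[of e ladder] e(1) by auto
  have "X \<in> Obj (spaces small t s)"
    using separation_homeomorphic_map[OF separation_ladder X(3)] X(1) e(2) by (simp add: spaces_sel)
  then obtain P p q where prod: "is_binary_product (spaces small t s) X X P p q"
    using prods unfolding has_binary_products_def by blast
  note prod = prod[unfolded is_binary_product_def spaces_sel(2,3)]
  have P: "small (topspace P)" "separation t s P"
    using conjunct1[OF prod] by (simp_all add: spaces_sel)
  have p: "p \<in> open_maps P X"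
    by (rule prod[THEN conjunct2, THEN conjunct1])
  have q: "q \<in> open_maps P X"
    by (rule prod[THEN conjunct2, THEN conjunct2, THEN conjunct1])
  have ex1: "\<exists>!h. h \<in> open_maps Z P \<and> compose (topspace Z) p h = f \<and> compose (topspace Z) q h = g"
    if "small (topspace Z)" "separation t s Z" "f \<in> open_maps Z X" "g \<in> open_maps Z X" for Z f g
    by (rule prod[THEN conjunct2, THEN conjunct2, THEN conjunct2, rule_format])
      (use that in \<open>simp_all add: spaces_sel\<close>)
  have e_co: "continuous_open_map ladder X e" and d_co: "continuous_open_map X ladder d"
    using X(2,3) by (auto intro: homeomorphic_imp_continuous_map homeomorphic_imp_open_map)
  have ed: "e (d y) = y" if "y \<in> topspace X" for y
    using that de unfolding X(1) by auto
  have p_co: "continuous_open_map P X p" and q_co: "continuous_open_map P X q"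
    using p q by (auto simp: open_maps_def)
  interpret ladder_square small t s P "\<lambda>x. d (p x)" "\<lambda>x. d (q x)"
  proof unfold_locales
    show "continuous_open_map P ladder (\<lambda>x. d (p x))" "continuous_open_map P ladder (\<lambda>x. d (q x))"
      by (rule continuous_open_map_compose[OF p_co d_co] continuous_open_map_compose[OF q_co d_co])+
  next
    fix Z :: "'u topology" and f g
    assume Z: "small (topspace Z)" "separation t s Z"
      and f: "continuous_open_map Z ladder f" and g: "continuous_open_map Z ladder g"
    let ?f = "restrict (\<lambda>z. e (f z)) (topspace Z)" and ?g = "restrict (\<lambda>z. e (g z)) (topspace Z)"
    have "?f \<in> open_maps Z X" "?g \<in> open_maps Z X"
      by (rule continuous_open_map_restrict, rule continuous_open_map_compose[OF _ e_co], rule f g)+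
    then obtain h where h: "h \<in> open_maps Z P" "compose (topspace Z) p h = ?f" "compose (topspace Z) q h = ?g"
      using ex1[OF Z] by metis
    have "d (p (h z)) = f z \<and> d (q (h z)) = g z" if "z \<in> topspace Z" for z
      using fun_cong[OF h(2), of z] fun_cong[OF h(3), of z] that de by (simp add: compose_def)
    with h(1) show "\<exists>h. continuous_open_map Z P h \<and> (\<forall>z\<in>topspace Z. d (p (h z)) = f z \<and> d (q (h z)) = g z)"
      by (auto simp: open_maps_def)
  next
    fix Z :: "'u topology" and h k z
    assume Z: "small (topspace Z)" "separation t s Z"
      and h: "continuous_open_map Z P h" and k: "continuous_open_map Z P k"
      and eq: "\<forall>z\<in>topspace Z. d (p (h z)) = d (p (k z)) \<and> d (q (h z)) = d (q (k z))"
      and z: "z \<in> topspace Z"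
    let ?h = "restrict h (topspace Z)" and ?k = "restrict k (topspace Z)"
    have hk: "?h \<in> open_maps Z P" "?k \<in> open_maps Z P"
      using h k by (auto intro: continuous_open_map_restrict)
    have in_X: "r (m z) \<in> topspace X" if "continuous_open_map P X r" "continuous_open_map Z P m" "z \<in> topspace Z" for r m z
      using that by (auto simp: continuous_map_def Pi_iff)
    have same: "compose (topspace Z) r ?h = compose (topspace Z) r ?k"
      if r: "continuous_open_map P X r" "\<forall>z\<in>topspace Z. d (r (h z)) = d (r (k z))" for r
    proof
      fix z
      show "compose (topspace Z) r ?h z = compose (topspace Z) r ?k z"
      proof (cases "z \<in> topspace Z")
        case True
        then have "r (h z) = e (d (r (h z)))" "e (d (r (k z))) = r (k z)"
          using ed[OF in_X[OF r(1) h]] ed[OF in_X[OF r(1) k]] by auto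
        with True r(2) show ?thesis
          by (simp add: compose_def)
      qed (simp add: compose_def)
    qed
    have "compose (topspace Z) p ?h = compose (topspace Z) p ?k"
      by (rule same[OF p_co]) (simp add: eq)
    moreover have "compose (topspace Z) q ?h = compose (topspace Z) q ?k"
      by (rule same[OF q_co]) (simp add: eq)
    moreover have "compose (topspace Z) p ?h \<in> open_maps Z X" "compose (topspace Z) q ?h \<in> open_maps Z X"
      using hk p q by (auto intro: compose_in_open_maps)
    ultimately have "?h = ?k"
      using ex1[OF Z] hk by metis
    then show "h z = k z"
      using z by (metis restrict_apply')
  qed (use small P in auto)
  show False
    by (rule ladder_square_impossible)
qed

theorem theorem3p7:
  fixes small :: "'u set \<Rightarrow> bool"
  assumes "smallness small"
  shows "\<not> has_binary_products (TopOpen small) \<and>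
         \<not> has_binary_products (TopOpen0 small) \<and>
         \<not> has_binary_products (SobOpen small)"
  unfolding spaces_instances using no_binary_products_spaces[OF assms] by blast

end
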